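(* In the interval-censoring setting described in the context, let $n^{-1}\sum_{i=1}^n M_{ni}^\gamma=O(1)$ as $n\to\infty$ for some $\gamma>1/2$. (i) Suppose that $\liminf_{n\to\infty}H_n([x,y])>0$ for two real numbers $x\le y$. Then $$\hat F_n(x)\le F(y)+o_p(1)\quad\text{and}\quad \hat F_n(y)\ge F(x)+o_p(1).$$ (ii) Let $-\infty\le a<b\le\infty$ be such that $\liminf_{n\to\infty}H_n((x,y))>0$ whenever $a\le x<y\le b$. Then $\hat F_n(x)\to_p F(x)$ for any $x\in(a,b)$.
   Context: Parameter space: $\Theta$ is the set of all pairs $(\phi,q)$ with $q\in[0,1)$ and $\phi:\mathbb R\to[-\infty,\infty)$ concave and upper semicontinuous such that $\int_{\mathbb R} e^{\phi(x)}\,dx+q=1$. For Borel $B\subset(-\infty,\infty]$, $P_{\phi,q}(B)=\int_{B\cap\mathbb R} e^{\phi(x)}\,dx+1_{[\infty\in B]}\,q$. Setting (interval-censoring): $P=P_{\phi,q}$ for some $(\phi,q)\in\Theta$, and $X_1,X_2,\dots$ are independent with distribution $P$ on $(-\infty,\infty]$. $A\in[-\infty,\infty)$ is a known lower bound for the support of $P$. For each $n$ and $1\le i\le n$, fixed (non-random) design points $A=:T_{n,i,0}<T_{n,i,1}<\dots<T_{n,i,M_{ni}}<T_{n,i,M_{ni}+1}:=\infty$ are given, with $M_{ni}\ge1$ an integer. The $i$-th observation $\widetilde X_i=\widetilde X_{n,i}$ is the unique interval among $\mathcal T_{n,i,j}=(T_{n,i,j-1},T_{n,i,j}]$, $1\le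 j\le M_{ni}+1$, containing $X_i$. The estimator $(\hat\phi_n,\hat q_n)$ is a maximum-likelihood estimator, i.e. a maximizer over $\Theta$ of $$\ell(\psi,r)=\frac1n\sum_{i=1}^n\log P_{\psi,r}(\widetilde X_{n,i}),$$ and $\hat P_n=P_{\hat\phi_n,\hat q_n}$. $F,\hat F_n:[-\infty,\infty]\to[0,1]$ are the distribution functions of $P$ and $\hat P_n$. For $B\subset\mathbb R$, $$H_n(B)=\frac1n\sum_{i=1}^n\max_{j=1,\dots,M_{ni}}1_{[T_{n,i,j}\in B]}.$$ Asymptotic statements are as $n\to\infty$; $\to_p$ is convergence in probability; "$U_n\le c+o_p(1)$" means $\max\{U_n-c,0\}\to_p0$, and "$U_n\ge c+o_p(1)$" means $\max\{c-U_n,0\}\to_p0$. *)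

theory Defs
  imports "HOL-Probability.Probability" "HOL-Library.Landau_Symbols"
begin

section \<open>The parameter space and the distributions\<close>

text \<open>In \<open>concave_ext\<close> the extended sum is harmless: for functions with values in
  \<open>[-\<infinity>, \<infinity>)\<close> and \<open>t\<close> strictly between 0 and 1 neither \<open>0 * (-\<infinity>)\<close> nor \<open>\<infinity> - \<infinity>\<close> occurs.\<close>

definition concave_ext :: "(real \<Rightarrow> ereal) \<Rightarrow> bool" where
  "concave_ext \<phi> \<longleftrightarrow> (\<forall>x y t. 0 < t \<and> t < 1 \<longrightarrow>
     ereal (1 - t) * \<phi> x + ereal t * \<phi> y \<le> \<phi> ((1 - t) * x + t * y))"

definition upper_semicont :: "(real \<Rightarrow> ereal) \<Rightarrow> bool" where
  "upper_semicont \<phi> \<longleftrightarrow> (\<forall>x. Limsup (at x) \<phi> \<le> \<phi> x)"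

definition exp_ext :: "ereal \<Rightarrow> ennreal" where
  "exp_ext x = (if x = \<infinity> then \<infinity> else if x = -\<infinity> then 0 else ennreal (exp (real_of_ereal x)))"

definition Theta :: "((real \<Rightarrow> ereal) \<times> real) set" where
  "Theta = {(\<phi>, q). 0 \<le> q \<and> q < 1 \<and> (\<forall>x. \<phi> x \<noteq> \<infinity>) \<and>
     concave_ext \<phi> \<and> upper_semicont \<phi> \<and>
     (\<integral>\<^sup>+x. exp_ext (\<phi> x) \<partial>lborel) + ennreal q = 1}"

text \<open>Distributions on \<open>(-\<infinity>, \<infinity>]\<close> are represented as Borel measures on the extended reals
  without mass at \<open>-\<infinity>\<close>. That the set function below really is a probability measure for
  parameters in \<open>Theta\<close> is shown in \<open>emeasure_cure_dist\<close> and \<open>prob_space_cure_dist\<close>.\<close>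

definition cure_dist :: "(real \<Rightarrow> ereal) \<Rightarrow> real \<Rightarrow> ereal measure" where
  "cure_dist \<phi> q = measure_of UNIV (sets borel)
     (\<lambda>B. (\<integral>\<^sup>+x. exp_ext (\<phi> x) * indicator B (ereal x) \<partial>lborel) + ennreal q * indicator B \<infinity>)"

definition cdf_ext :: "ereal measure \<Rightarrow> ereal \<Rightarrow> real" where
  "cdf_ext P x = measure P {..x}"

definition measure_support :: "'a::topological_space measure \<Rightarrow> 'a set" where
  "measure_support P = {x. \<forall>U. open U \<and> x \<in> U \<longrightarrow> emeasure P U > 0}"


section \<open>Interval-censored observations and the log-likelihood\<close>

text \<open>For one observation, \<open>t 0 < \<dots> < t (k + 1)\<close> are the design points including the two
  end points, so \<open>k\<close> is the number of inspection times. The observed interval is meaningful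
  only if \<open>x\<close> lies in \<open>(t 0, t (k + 1)]\<close>.\<close>

definition obs_interval :: "(nat \<Rightarrow> ereal) \<Rightarrow> nat \<Rightarrow> ereal \<Rightarrow> ereal set" where
  "obs_interval t k x = (THE I. I \<in> (\<lambda>j. {t (j - 1)<..t j}) ` {1..k + 1} \<and> x \<in> I)"

definition ln_ext :: "real \<Rightarrow> ereal" where
  "ln_ext p = (if p = 0 then -\<infinity> else ereal (ln p))"

definition loglik :: "nat \<Rightarrow> (nat \<Rightarrow> ereal set) \<Rightarrow> (real \<Rightarrow> ereal) \<times> real \<Rightarrow> ereal" where
  "loglik n I = (\<lambda>(\<psi>, r). ereal (1 / real n) * (\<Sum>i = 1..n. ln_ext (measure (cure_dist \<psi> r) (I i))))"

definition design_freq ::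
    "(nat \<Rightarrow> nat \<Rightarrow> nat \<Rightarrow> ereal) \<Rightarrow> (nat \<Rightarrow> nat \<Rightarrow> nat) \<Rightarrow> nat \<Rightarrow> real set \<Rightarrow> real" where
  "design_freq T m n B =
     (1 / real n) * (\<Sum>i = 1..n. MAX j\<in>{1..m n i}. indicator (ereal ` B) (T n i j))"


section \<open>Convergence in probability\<close>

text \<open>Outer probability is used because a maximum-likelihood estimator is only required to
  maximize the likelihood for almost every \<open>\<omega>\<close>; no measurable selection is assumed. For random
  variables this is the usual convergence in probability, see \<open>tendsto_in_prob_measurable\<close>.\<close>

definition tendsto_in_prob :: "'a measure \<Rightarrow> (nat \<Rightarrow> 'a \<Rightarrow> real) \<Rightarrow> real \<Rightarrow> bool" where
  "tendsto_in_prob M U c \<longleftrightarrow>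
     (\<forall>\<epsilon>>0. (\<lambda>n. outer_measure_of M {\<omega> \<in> space M. \<bar>U n \<omega> - c\<bar> > \<epsilon>}) \<longlonglongrightarrow> 0)"

definition le_plus_op :: "'a measure \<Rightarrow> (nat \<Rightarrow> 'a \<Rightarrow> real) \<Rightarrow> real \<Rightarrow> bool" where
  "le_plus_op M U c \<longleftrightarrow> tendsto_in_prob M (\<lambda>n \<omega>. max (U n \<omega> - c) 0) 0"

definition ge_plus_op :: "'a measure \<Rightarrow> (nat \<Rightarrow> 'a \<Rightarrow> real) \<Rightarrow> real \<Rightarrow> bool" where
  "ge_plus_op M U c \<longleftrightarrow> tendsto_in_prob M (\<lambda>n \<omega>. max (c - U n \<omega>) 0) 0"


section \<open>Well-definedness\<close>

lemma tendsto_in_prob_measurable: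
  assumes "prob_space M" and [measurable]: "\<And>n. U n \<in> borel_measurable M"
  shows "tendsto_in_prob M U c \<longleftrightarrow>
    (\<forall>\<epsilon>>0. (\<lambda>n. measure M {\<omega> \<in> space M. \<bar>U n \<omega> - c\<bar> > \<epsilon>}) \<longlonglongrightarrow> 0)"
proof -
  interpret prob_space M by fact
  have "outer_measure_of M {\<omega> \<in> space M. \<bar>U n \<omega> - c\<bar> > \<epsilon>} =
      ennreal (measure M {\<omega> \<in> space M. \<bar>U n \<omega> - c\<bar> > \<epsilon>})" for n \<epsilon>
    by (simp add: emeasure_eq_measure)
  then show ?thesis
    unfolding tendsto_in_prob_def by (simp add: ennreal_0[symmetric] del: ennreal_0)
qed

lemma upper_semicont_measurable:
  assumes "upper_semicont \<phi>"
  shows "\<phi> \<in> borel_measurable borel"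
proof -
  have "open {x. \<phi> x < a}" for a
  proof (subst open_subopen, safe)
    fix x assume x: "\<phi> x < a"
    with assms have "Limsup (at x) \<phi> < a"
      unfolding upper_semicont_def using le_less_trans by blast
    then have "eventually (\<lambda>y. \<phi> y < a) (at x)" by (rule Limsup_lessD)
    then obtain S where "open S" "x \<in> S" "\<forall>y\<in>S. y \<noteq> x \<longrightarrow> \<phi> y < a"
      unfolding eventually_at_topological by blast
    with x show "\<exists>S. open S \<and> x \<in> S \<and> S \<subseteq> {x. \<phi> x < a}"
      by (intro exI[of _ S]) auto
  qed
  then have "{x \<in> space borel. \<phi> x < a} \<in> sets borel" for a by simp
  then show ?thesis by (intro borel_measurableI_less) simp
qed

lemma exp_ext_measurable [measurable]: "exp_ext \<in> borel_measurable borel"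
  unfolding exp_ext_def[abs_def] by measurable

lemma sets_cure_dist [simp, measurable_cong]: "sets (cure_dist \<phi> q) = sets borel"
  and space_cure_dist [simp]: "space (cure_dist \<phi> q) = UNIV"
  using sets.sigma_sets_eq[of "borel :: ereal measure"] by (simp_all add: cure_dist_def)

lemma emeasure_cure_dist:
  assumes \<theta>: "(\<phi>, q) \<in> Theta" and B: "B \<in> sets borel"
  shows "emeasure (cure_dist \<phi> q) B =
    (\<integral>\<^sup>+x. exp_ext (\<phi> x) * indicator B (ereal x) \<partial>lborel) + ennreal q * indicator B \<infinity>"
proof -
  have [measurable]: "\<phi> \<in> borel_measurable borel"
    using \<theta> by (auto simp: Theta_def intro: upper_semicont_measurable)
  define D where "D = distr (density lborel (\<lambda>x. exp_ext (\<phi> x))) borel ereal"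
  define \<mu> where "\<mu> = (\<lambda>B. (\<integral>\<^sup>+x. exp_ext (\<phi> x) * indicator B (ereal x) \<partial>lborel) + ennreal q * indicator B \<infinity>)"
  have \<mu>: "\<mu> B = emeasure D B + ennreal q * emeasure (return borel \<infinity>) B" if "B \<in> sets borel" for B
  proof -
    have [measurable]: "B \<in> sets borel" by fact
    have "emeasure D B = (\<integral>\<^sup>+x. exp_ext (\<phi> x) * indicator (ereal -` B) x \<partial>lborel)"
      unfolding D_def
      using measurable_sets_borel[OF borel_measurable_ereal[OF measurable_ident] \<open>B \<in> sets borel\<close>]
      by (simp add: emeasure_distr emeasure_density)
    also have "\<dots> = (\<integral>\<^sup>+x. exp_ext (\<phi> x) * indicator B (ereal x) \<partial>lborel)"
      by (intro nn_integral_cong) (simp add: indicator_def)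
    finally show ?thesis by (simp add: \<mu>_def)
  qed
  have "emeasure (cure_dist \<phi> q) B = \<mu> B"
  proof (rule emeasure_measure_of)
    show "cure_dist \<phi> q = measure_of UNIV (sets borel) \<mu>"
      by (simp add: cure_dist_def \<mu>_def)
    show "positive (sets (cure_dist \<phi> q)) \<mu>"
      by (simp add: positive_def \<mu>_def)
    show "countably_additive (sets (cure_dist \<phi> q)) \<mu>"
    proof (rule countably_additiveI)
      fix A :: "nat \<Rightarrow> ereal set"
      assume A: "range A \<subseteq> sets (cure_dist \<phi> q)" "disjoint_family A"
        "(\<Union>i. A i) \<in> sets (cure_dist \<phi> q)"
      have "(\<Sum>i. \<mu> (A i)) =
          (\<Sum>i. emeasure D (A i) + ennreal q * emeasure (return borel \<infinity>) (A i))"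
        using A by (intro suminf_cong \<mu>) auto
      also have "\<dots> = (\<Sum>i. emeasure D (A i)) + ennreal q * (\<Sum>i. emeasure (return borel \<infinity>) (A i))"
        by (simp add: suminf_add[symmetric] ennreal_suminf_cmult)
      also have "\<dots> = \<mu> (\<Union>i. A i)"
        using A by (simp add: \<mu> suminf_emeasure D_def del: emeasure_return)
      finally show "(\<Sum>i. \<mu> (A i)) = \<mu> (\<Union>i. A i)" .
    qed
  qed (use B in auto)
  then show ?thesis by (simp add: \<mu>_def)
qed

lemma prob_space_cure_dist:
  assumes "(\<phi>, q) \<in> Theta"
  shows "prob_space (cure_dist \<phi> q)" and "measure (cure_dist \<phi> q) {-\<infinity>} = 0"
proof -
  show "prob_space (cure_dist \<phi> q)"
    using assms by (intro prob_spaceI) (simp add: emeasure_cure_dist Theta_def)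
  show "measure (cure_dist \<phi> q) {-\<infinity>} = 0"
    using assms by (simp add: measure_def emeasure_cure_dist)
qed

lemma obs_interval_eq:
  assumes lt: "\<And>j. j \<le> k \<Longrightarrow> t j < t (Suc j)"
    and j: "j \<in> {1..k + 1}" "x \<in> {t (j - 1)<..t j}"
  shows "obs_interval t k x = {t (j - 1)<..t j}"
  unfolding obs_interval_def
proof (rule the_equality)
  have mono: "t a \<le> t b" if "a \<le> b" "b \<le> k + 1" for a b
    using that
  proof (induction b rule: dec_induct)
    case (step b)
    then show ?case using lt[of b] by auto
  qed simp
  fix I assume "I \<in> (\<lambda>j. {t (j - 1)<..t j}) ` {1..k + 1} \<and> x \<in> I"
  then obtain i where i: "i \<in> {1..k + 1}" "I = {t (i - 1)<..t i}" "x \<in> I" by auto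
  have "\<not> i < j" "\<not> j < i"
    using mono[of i "j - 1"] mono[of j "i - 1"] i j
    by (fastforce dest: less_le_trans le_less_trans)+
  then show "I = {t (j - 1)<..t j}" using i by simp
qed (use j in auto)

end

theory Submission
  imports Defs "HOL-Real_Asymp.Real_Asymp"
begin

text \<open>Since the estimator maximizes the likelihood, the product over \<open>i\<close> of the square roots of the
  likelihood ratios of \<open>Fhat\<close> against \<open>F\<close> is at least 1. For a fixed distribution function \<open>G\<close>
  the expectation of this product is the product of the Hellinger affinities of the cell
  probabilities. An affinity is at most 1, and at most \<open>1 - e\<^sup>2 / 2\<close> if \<open>G\<close> and \<open>F\<close> differ by \<open>e\<close> at an
  inspection time of the observation. So by Markov's inequality a \<open>G\<close> that is \<open>e\<close> away from \<open>F\<close> on a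
  set hit by a positive fraction of the observations has exponentially small probability of
  beating \<open>F\<close>.

  To pass to the random \<open>Fhat\<close>, round \<open>N * G\<close> down on the design points: this leaves polynomially
  (in \<open>n\<close>) many step functions, and replacing cell probabilities by upper bounds that exceed them by
  at most \<open>2 / N\<close> raises the affinity of observation \<open>i\<close> by at most \<open>2 * sqrt (m n i / N)\<close>. The moment
  condition with \<open>\<gamma> > 1 / 2\<close> makes the average of these errors \<open>O (1 / sqrt N)\<close>, so a large fixed \<open>N\<close>
  and a union bound suffice.\<close>

section \<open>Affinities and monotone step functions\<close>

lemma sum_sqrt_mult_le:
  fixes f g :: "'i \<Rightarrow> real"
  assumes "\<And>i. i \<in> I \<Longrightarrow> 0 \<le> f i" "\<And>i. i \<in> I \<Longrightarrow> 0 \<le> g i"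
  shows "(\<Sum>i\<in>I. sqrt (f i) * sqrt (g i)) \<le> sqrt (sum f I) * sqrt (sum g I)"
proof -
  have "(\<Sum>i\<in>I. sqrt (f i) * sqrt (g i)) = (\<Sum>i\<in>I. \<bar>sqrt (f i)\<bar> * \<bar>sqrt (g i)\<bar>)"
    using assms by (intro sum.cong) auto
  also have "\<dots> \<le> L2_set (\<lambda>i. sqrt (f i)) I * L2_set (\<lambda>i. sqrt (g i)) I"
    by (rule L2_set_mult_ineq)
  also have "\<dots> = sqrt (sum f I) * sqrt (sum g I)"
    using assms by (simp add: L2_set_def)
  finally show ?thesis .
qed

text \<open>With \<open>r = sqrt a\<close> and so on, \<open>(r, r')\<close> and
  \<open>(s, s')\<close> are unit vectors. The left side is their inner product, and
  \<open>a - b\<close> is their cross product times a factor of modulus at most 1. So the squared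
  inner product is at most \<open>1 - (a - b)^2\<close>, and \<open>2 * t <= 1 + t^2\<close> removes
  the square.\<close>

lemma bernoulli_affinity_le:
  fixes a b :: real
  assumes "0 \<le> a" "a \<le> 1" "0 \<le> b" "b \<le> 1"
  shows "sqrt a * sqrt b + sqrt (1 - a) * sqrt (1 - b) \<le> 1 - (a - b)\<^sup>2 / 2"
proof -
  define r s r' s' where "r = sqrt a" "s = sqrt b" "r' = sqrt (1 - a)" "s' = sqrt (1 - b)"
  have pos: "0 \<le> r" "0 \<le> s" "0 \<le> r'" "0 \<le> s'"
    using assms by (auto simp: r_s_r'_s'_def)
  have sq: "r\<^sup>2 = a" "s\<^sup>2 = b" "r'\<^sup>2 = 1 - a" "s'\<^sup>2 = 1 - b"
    using assms by (auto simp: r_s_r'_s'_def)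
  have "(r * s' + s * r')\<^sup>2 + (r * s - r' * s')\<^sup>2 = (r\<^sup>2 + r'\<^sup>2) * (s\<^sup>2 + s'\<^sup>2)"
    by (simp add: power2_eq_square algebra_simps)
  also have "\<dots> = 1" by (simp add: sq)
  finally have le1: "(r * s' + s * r')\<^sup>2 \<le> 1"
    using zero_le_power2[of "r * s - r' * s'"] by linarith
  have "a - b = a * (1 - b) - b * (1 - a)" by (simp add: algebra_simps)
  also have "\<dots> = (r * s')\<^sup>2 - (s * r')\<^sup>2" by (simp add: power_mult_distrib sq)
  also have "\<dots> = (r * s' - s * r') * (r * s' + s * r')"
    by (simp add: power2_eq_square algebra_simps)
  finally have "(a - b)\<^sup>2 = (r * s' - s * r')\<^sup>2 * (r * s' + s * r')\<^sup>2"
    by (simp add: power_mult_distrib)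
  also have "\<dots> \<le> (r * s' - s * r')\<^sup>2"
    using le1 by (simp add: mult_left_le)
  also have "\<dots> = (r\<^sup>2 + r'\<^sup>2) * (s\<^sup>2 + s'\<^sup>2) - (r * s + r' * s')\<^sup>2"
    by (simp add: power2_eq_square algebra_simps)
  finally have "(r * s + r' * s')\<^sup>2 \<le> 1 - (a - b)\<^sup>2" by (simp add: sq)
  moreover have "2 * (r * s + r' * s') \<le> 1 + (r * s + r' * s')\<^sup>2"
    using zero_le_power2[of "r * s + r' * s' - 1"] by (simp add: power2_eq_square algebra_simps)
  ultimately show ?thesis by (simp add: r_s_r'_s'_def)
qed

text \<open>Merging all cells up to \<open>k\<close> and all cells after \<open>k\<close> does not
  lower the affinity, by Cauchy-Schwarz on each block. What remains are two two-point laws with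
  weights \<open>a k\<close> and \<open>b k\<close>.\<close>

lemma affinity_increments_le:
  fixes a b :: "nat \<Rightarrow> real"
  assumes a: "\<And>j. j \<in> {1..n} \<Longrightarrow> a (j - 1) \<le> a j" "a 0 = 0" "a n = 1"
    and b: "\<And>j. j \<in> {1..n} \<Longrightarrow> b (j - 1) \<le> b j" "b 0 = 0" "b n = 1"
    and k: "k \<le> n"
  shows "(\<Sum>j=1..n. sqrt (a j - a (j - 1)) * sqrt (b j - b (j - 1))) \<le> 1 - (a k - b k)\<^sup>2 / 2"
proof -
  let ?f = "\<lambda>j. sqrt (a j - a (j - 1)) * sqrt (b j - b (j - 1))"
  have split: "{1..n} = {Suc 0..k} \<union> {Suc k..n}" "{Suc 0..k} \<inter> {Suc k..n} = {}"
    using k by auto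
  have tele: "(\<Sum>j\<in>{Suc 0..k}. c j - c (j - 1)) = c k" "(\<Sum>j\<in>{Suc k..n}. c j - c (j - 1)) = 1 - c k"
    if "c 0 = 0" "c n = 1" for c :: "nat \<Rightarrow> real"
    using that k sum_telescope''[of 0 k c] sum_telescope''[of k n c] by simp_all
  have range: "0 \<le> c k" "c k \<le> 1"
    if "\<And>j. j \<in> {1..n} \<Longrightarrow> c (j - 1) \<le> c j" "c 0 = 0" "c n = 1" for c :: "nat \<Rightarrow> real"
  proof -
    have "0 \<le> (\<Sum>j\<in>{Suc 0..k}. c j - c (j - 1))" "0 \<le> (\<Sum>j\<in>{Suc k..n}. c j - c (j - 1))"
      using k that(1) by (force intro!: sum_nonneg)+
    then show "0 \<le> c k" "c k \<le> 1" using tele[of c] that by auto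
  qed
  have "sum ?f {1..n} = sum ?f {Suc 0..k} + sum ?f {Suc k..n}"
    by (subst split) (rule sum.union_disjoint; use split in simp)
  also have "\<dots> \<le> sqrt (a k) * sqrt (b k) + sqrt (1 - a k) * sqrt (1 - b k)"
  proof (rule add_mono)
    show "sum ?f {Suc 0..k} \<le> sqrt (a k) * sqrt (b k)"
      using sum_sqrt_mult_le[of "{Suc 0..k}" "\<lambda>j. a j - a (j - 1)" "\<lambda>j. b j - b (j - 1)"]
        tele(1)[of a] tele(1)[of b] a b k by simp
    show "sum ?f {Suc k..n} \<le> sqrt (1 - a k) * sqrt (1 - b k)"
      using sum_sqrt_mult_le[of "{Suc k..n}" "\<lambda>j. a j - a (j - 1)" "\<lambda>j. b j - b (j - 1)"]
        tele(2)[of a] tele(2)[of b] a b k by simp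
  qed
  also have "\<dots> \<le> 1 - (a k - b k)\<^sup>2 / 2"
    using range[of a] range[of b] a b by (intro bernoulli_affinity_le) auto
  finally show ?thesis .
qed

text \<open>By subadditivity of the square root the slack costs \<open>sqrt d\<close> times the sum
  of the square roots of the increments of \<open>b\<close>. These increments add up to 1, so
  Cauchy-Schwarz bounds the cost by \<open>sqrt (d * n)\<close>.\<close>

lemma affinity_bracket_le:
  fixes a b w :: "nat \<Rightarrow> real"
  assumes a: "\<And>j. j \<in> {1..n} \<Longrightarrow> a (j - 1) \<le> a j" "a 0 = 0" "a n = 1"
    and b: "\<And>j. j \<in> {1..n} \<Longrightarrow> b (j - 1) \<le> b j" "b 0 = 0" "b n = 1"
    and k: "k \<le> n"
    and w: "\<And>j. j \<in> {1..n} \<Longrightarrow> w j \<le> a j - a (j - 1) + d" and d: "0 \<le> d"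
  shows "(\<Sum>j=1..n. sqrt (w j) * sqrt (b j - b (j - 1))) \<le>
    1 - (a k - b k)\<^sup>2 / 2 + sqrt (d * n)"
proof -
  have "(\<Sum>j=1..n. sqrt (w j) * sqrt (b j - b (j - 1))) \<le>
    (\<Sum>j=1..n. sqrt (a j - a (j - 1)) * sqrt (b j - b (j - 1)) + sqrt d * sqrt (b j - b (j - 1)))"
  proof (rule sum_mono)
    fix j assume j: "j \<in> {1..n}"
    have "sqrt (w j) \<le> sqrt (a j - a (j - 1) + d)" using w[OF j] by simp
    also have "\<dots> \<le> sqrt (a j - a (j - 1)) + sqrt d"
      using a(1)[OF j] d by (intro sqrt_add_le_add_sqrt) auto
    finally have "sqrt (w j) * sqrt (b j - b (j - 1)) \<le>
      (sqrt (a j - a (j - 1)) + sqrt d) * sqrt (b j - b (j - 1))"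
      using b(1)[OF j] by (intro mult_right_mono) auto
    then show "sqrt (w j) * sqrt (b j - b (j - 1)) \<le>
      sqrt (a j - a (j - 1)) * sqrt (b j - b (j - 1)) + sqrt d * sqrt (b j - b (j - 1))"
      by (simp add: algebra_simps)
  qed
  also have "\<dots> = (\<Sum>j=1..n. sqrt (a j - a (j - 1)) * sqrt (b j - b (j - 1))) +
      (\<Sum>j=1..n. sqrt d * sqrt (b j - b (j - 1)))"
    by (rule sum.distrib)
  also have "(\<Sum>j=1..n. sqrt d * sqrt (b j - b (j - 1))) \<le> sqrt (n * d) * sqrt (b n - b 0)"
    using sum_sqrt_mult_le[of "{1..n}" "\<lambda>_. d" "\<lambda>j. b j - b (j - 1)"] d b(1)
      sum_telescope''[of 0 n b] by simp
  also have "(\<Sum>j=1..n. sqrt (a j - a (j - 1)) * sqrt (b j - b (j - 1))) \<le> 1 - (a k - b k)\<^sup>2 / 2"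
    by (rule affinity_increments_le[OF a b k])
  finally show ?thesis using b by (simp add: mult.commute)
qed

text \<open>Rounding \<open>N * G\<close> down turns a monotone \<open>G\<close> into a step function with at most \<open>N\<close> jumps.
  Coding it by its jump points gives a net of polynomial size \<open>card D ^ N\<close> on a finite design \<open>D\<close>.\<close>

definition threshold_count :: "nat \<Rightarrow> (nat \<Rightarrow> 'b::linorder) \<Rightarrow> 'b \<Rightarrow> nat" where
  "threshold_count N c t = card {k \<in> {1..N}. c k \<le> t}"

lemma monotone_quantization:
  fixes G :: "'b::linorder \<Rightarrow> real"
  assumes D: "finite D" "z \<in> D" and G: "mono_on D G" "\<And>t. t \<in> D \<Longrightarrow> 0 \<le> G t \<and> G t \<le> 1" "G z = 1"
  obtains c where "c \<in> {1..N} \<rightarrow>\<^sub>E D"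
    "\<And>t. t \<in> D \<Longrightarrow> real (threshold_count N c t) \<le> N * G t \<and> N * G t < real (threshold_count N c t) + 1"
proof
  let ?S = "\<lambda>k. {t \<in> D. real k \<le> N * G t}"
  \<comment> \<open>The jump point \<open>c k\<close> is the first design point at which
    \<open>N * G\<close> reaches \<open>k\<close>; it exists for every \<open>k\<close> up to
    \<open>N\<close> because \<open>G z = 1\<close>.\<close>
  define c where "c = (\<lambda>k\<in>{1..N}. Min (?S k))"
  have ne: "?S k \<noteq> {}" if "k \<in> {1..N}" for k
    using D G(3) that by (auto intro!: exI[of _ z])
  have Min: "Min (?S k) \<in> ?S k" if "k \<in> {1..N}" for k
    using ne[OF that] D by (intro Min_in) auto
  then show "c \<in> {1..N} \<rightarrow>\<^sub>E D" by (auto simp: c_def)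
  fix t assume t: "t \<in> D"
  \<comment> \<open>So \<open>c\<close> is a generalized inverse of \<open>N * G\<close>: one
    direction is monotonicity of \<open>G\<close>, the other minimality of \<open>c k\<close>.
    Counting the \<open>k\<close> then yields the integer part of \<open>N * G t\<close>.\<close>
  have "c k \<le> t \<longleftrightarrow> real k \<le> N * G t" if k: "k \<in> {1..N}" for k
  proof
    assume "c k \<le> t"
    then have "G (c k) \<le> G t" using Min[OF k] G(1) t k by (auto simp: c_def mono_on_def)
    then have "N * G (c k) \<le> N * G t" by (rule mult_left_mono) simp
    moreover have "real k \<le> N * G (c k)" using Min[OF k] k by (simp add: c_def)
    ultimately show "real k \<le> N * G t" by linarith
  next
    assume "real k \<le> N * G t"
    then show "c k \<le> t" using t k D by (auto simp: c_def intro!: Min_le)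
  qed
  then have "{k \<in> {1..N}. c k \<le> t} = {k \<in> {1..N}. real k \<le> N * G t}" by blast
  also have "\<dots> = {1..nat \<lfloor>N * G t\<rfloor>}"
  proof -
    have "N * G t \<le> N" "0 \<le> N * G t" using G(2)[OF t] by (auto simp: mult_left_le)
    then show ?thesis by (auto simp: le_nat_floor) linarith+
  qed
  finally have "threshold_count N c t = nat \<lfloor>N * G t\<rfloor>" by (simp add: threshold_count_def)
  moreover have "0 \<le> N * G t" using G(2)[OF t] by auto
  ultimately show "real (threshold_count N c t) \<le> N * G t \<and> N * G t < real (threshold_count N c t) + 1"
    by linarith
qed

lemma threshold_count_mono:
  assumes "s \<le> t" shows "threshold_count N c s \<le> threshold_count N c t"
  unfolding threshold_count_def using assms by (intro card_mono) auto

section \<open>Exponential decay against a net of polynomial size, Markov's inequality, outer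
  measure\<close>

lemma power_times_exp_tendsto_0:
  fixes \<kappa> :: real
  assumes "0 < \<kappa>"
  shows "(\<lambda>n::nat. (K * real n ^ 2) ^ N * exp (- \<kappa> * real n)) \<longlonglongrightarrow> 0"
proof -
  have "(\<lambda>n::nat. real n ^ k * exp (- \<kappa> * real n)) \<longlonglongrightarrow> 0" for k
    using assms by real_asymp
  from tendsto_mult_left[OF this[of "2 * N"], of "K ^ N"] show ?thesis
    by (simp add: power_mult_distrib power_mult mult.assoc)
qed

text \<open>Independence factorizes the expectation of the product, and
  \<open>x <= exp (x - 1)\<close> turns the factors into a sum of deficits that can be estimated one
  observation at a time.\<close>

lemma (in prob_space) prod_indep_Markov:
  fixes Z :: "'i \<Rightarrow> 'a \<Rightarrow> real"
  assumes I: "finite I" and ind: "indep_vars (\<lambda>_. borel) Z I"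
    and int: "\<And>i. i \<in> I \<Longrightarrow> integrable M (Z i)" and pos: "\<And>i \<omega>. i \<in> I \<Longrightarrow> 0 \<le> Z i \<omega>"
  shows "prob {\<omega> \<in> space M. 1 \<le> (\<Prod>i\<in>I. Z i \<omega>)} \<le> exp (\<Sum>i\<in>I. expectation (Z i) - 1)"
proof -
  have "prob {\<omega> \<in> space M. 1 \<le> (\<Prod>i\<in>I. Z i \<omega>)} \<le> expectation (\<lambda>\<omega>. \<Prod>i\<in>I. Z i \<omega>) / 1"
    using indep_vars_integrable[OF I ind int] pos
    by (intro integral_Markov_inequality_measure[where A = "{}"]) (auto intro!: prod_nonneg)
  also have "\<dots> = (\<Prod>i\<in>I. expectation (Z i))"
    using indep_vars_lebesgue_integral[OF I ind int] by simp
  also have "\<dots> \<le> (\<Prod>i\<in>I. exp (expectation (Z i) - 1))"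
    using exp_ge_add_one_self pos by (intro prod_mono) (auto intro: integral_nonneg_AE order_trans[OF _ exp_ge_add_one_self])
  also have "\<dots> = exp (\<Sum>i\<in>I. expectation (Z i) - 1)" using I by (simp add: exp_sum)
  finally show ?thesis .
qed

lemma real_sqrt_prod: "sqrt (prod f I) = (\<Prod>i\<in>I. sqrt (f i))"
  by (induction I rule: infinite_finite_induct) (simp_all add: real_sqrt_mult)

text \<open>The exceptional null set is added to a measurable cover that attains the outer measure
  of \<open>S'\<close>. This form is needed since the estimator maximizes only almost surely and its
  events need not be measurable.\<close>

lemma outer_measure_of_mono_AE:
  assumes AE: "AE x in M. x \<in> S \<longrightarrow> x \<in> S'" and S: "S \<subseteq> space M" "S' \<subseteq> space M"
  shows "outer_measure_of M S \<le> outer_measure_of M S'"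
proof -
  obtain Z where Z: "Z \<in> null_sets M" "{x \<in> space M. \<not> (x \<in> S \<longrightarrow> x \<in> S')} \<subseteq> Z"
    using AE by (auto simp: eventually_ae_filter)
  obtain E where E: "E \<in> sets M" "S' \<subseteq> E" "outer_measure_of M S' = emeasure M E"
    using outer_measure_of_attain[OF S(2)] by blast
  have "S \<subseteq> E \<union> Z" using S(1) Z(2) E(2) by blast
  then have "outer_measure_of M S \<le> outer_measure_of M (E \<union> Z)" by (rule outer_measure_of_mono)
  also have "\<dots> = emeasure M E" using E(1) Z(1) by (simp add: emeasure_Un_null_set null_setsD2 sets.Un)
  finally show ?thesis using E(3) by simp
qed

lemma outer_measure_of_Un_le:
  assumes S: "S \<subseteq> space M" "S' \<subseteq> space M"
  shows "outer_measure_of M (S \<union> S') \<le> outer_measure_of M S + outer_measure_of M S'"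
proof -
  obtain E where E: "E \<in> sets M" "S \<subseteq> E" "outer_measure_of M S = emeasure M E"
    using outer_measure_of_attain[OF S(1)] by blast
  obtain E' where E': "E' \<in> sets M" "S' \<subseteq> E'" "outer_measure_of M S' = emeasure M E'"
    using outer_measure_of_attain[OF S(2)] by blast
  have "outer_measure_of M (S \<union> S') \<le> outer_measure_of M (E \<union> E')"
    using E(2) E'(2) by (intro outer_measure_of_mono) auto
  also have "\<dots> = emeasure M (E \<union> E')" using E(1) E'(1) by (intro outer_measure_of_eq) auto
  also have "\<dots> \<le> emeasure M E + emeasure M E'" by (rule emeasure_subadditive[OF E(1) E'(1)])
  finally show ?thesis using E(3) E'(3) by simp
qed


section \<open>Distribution functions and likelihoods\<close>

lemma measure_cure_dist_singleton:
  assumes "(\<phi>, q) \<in> Theta"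
  shows "measure (cure_dist \<phi> q) {ereal x} = 0"
proof -
  have "(\<integral>\<^sup>+y. exp_ext (\<phi> y) * indicator {ereal x} (ereal y) \<partial>lborel) = (\<integral>\<^sup>+y. 0 \<partial>(lborel :: real measure))"
    using AE_lborel_singleton[of x] by (intro nn_integral_cong_AE) (auto simp: indicator_def)
  then show ?thesis
    using assms by (simp add: measure_def emeasure_cure_dist)
qed

lemma measure_greaterThanAtMost_cdf_ext:
  assumes "prob_space P" "sets P = sets borel" "a \<le> b"
  shows "measure P {a<..b} = cdf_ext P b - cdf_ext P a"
proof -
  interpret prob_space P by fact
  have "{a<..b} = {..b} - {..a}" by auto
  then show ?thesis
    using assms by (simp add: cdf_ext_def finite_measure_Diff)
qed

lemma cdf_ext_mono:
  assumes "prob_space P" "sets P = sets borel" "a \<le> b"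
  shows "cdf_ext P a \<le> cdf_ext P b"
  using measure_greaterThanAtMost_cdf_ext[OF assms] measure_nonneg[of P "{a<..b}"] by simp

lemma cdf_ext_range:
  assumes "prob_space P" shows "0 \<le> cdf_ext P a" "cdf_ext P a \<le> 1"
  using prob_space.prob_le_1[OF assms] by (auto simp: cdf_ext_def)

lemma cdf_ext_PInfty:
  assumes "prob_space P" "sets P = sets borel" shows "cdf_ext P \<infinity> = 1"
proof -
  have "{..\<infinity>::ereal} = space P" using sets_eq_imp_space_eq[OF assms(2)] by auto
  then show ?thesis
    unfolding cdf_ext_def using prob_space.prob_space[OF assms(1)] by simp
qed

section \<open>Null sets off the support and one-sided continuity of distribution functions\<close>

lemma measure_support_null:
  fixes P :: "'b::second_countable_topology measure"
  assumes "sets P = sets borel" "S \<inter> measure_support P = {}" "S \<in> sets P"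
  shows "S \<in> null_sets P"
proof -
  let ?\<F> = "{U. open U \<and> emeasure P U = 0}"
  \<comment> \<open>The complement of the support is the union of all open null sets; by second
    countability countably many of them already cover it.\<close>
  obtain \<F> where F: "\<F> \<subseteq> ?\<F>" "countable \<F>" "\<Union>\<F> = \<Union>?\<F>"
    using Lindelof[of ?\<F>] by auto
  have "(\<Union>U\<in>\<F>. U) \<in> null_sets P"
    using F assms(1) by (intro null_sets_UN') (auto simp: null_sets_def)
  moreover have "S \<subseteq> \<Union>\<F>"
  proof
    fix x assume "x \<in> S"
    then have "x \<notin> measure_support P" using assms(2) by blast
    then obtain U where "open U" "x \<in> U" "\<not> 0 < emeasure P U"
      unfolding measure_support_def by blast
    then have "U \<in> ?\<F>" "x \<in> U" by auto
    then show "x \<in> \<Union>\<F>" unfolding F(3) by blast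
  qed
  ultimately show ?thesis using assms(3) by (auto intro: null_sets_subset)
qed

text \<open>The point \<open>A\<close> may lie in the support, so the support argument covers only
  \<open>{..<A}\<close>. The singleton \<open>{A}\<close> is null because the distribution has a
  density on the reals and no mass at \<open>-\<infinity>\<close>.\<close>

lemma cdf_ext_below_support:
  assumes \<theta>: "(\<phi>, q) \<in> Theta" and A: "A < \<infinity>" "\<And>x. x \<in> measure_support (cure_dist \<phi> q) \<Longrightarrow> A \<le> x"
  shows "cdf_ext (cure_dist \<phi> q) A = 0"
proof -
  let ?P = "cure_dist \<phi> q"
  interpret P: prob_space ?P by (rule prob_space_cure_dist[OF \<theta>])
  have "{..<A} \<in> null_sets ?P"
    using A(2) by (intro measure_support_null) (force simp: not_less[symmetric])+
  moreover have "{A} \<in> null_sets ?P"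
    using A(1) measure_cure_dist_singleton[OF \<theta>] prob_space_cure_dist(2)[OF \<theta>]
    by (cases A) (auto simp: null_sets_def P.emeasure_eq_measure)
  ultimately have "{..<A} \<union> {A} \<in> null_sets ?P" by (rule null_sets.Un)
  also have "{..<A} \<union> {A} = {..A}" by auto
  finally show ?thesis by (simp add: cdf_ext_def measure_eq_0_null_sets)
qed

lemma cdf_ext_right_approx:
  fixes P :: "ereal measure"
  assumes "prob_space P" "sets P = sets borel" and x: "ereal x < b" and e: "0 < e"
  obtains y where "x < y" "ereal y < b" "cdf_ext P (ereal y) < cdf_ext P (ereal x) + e"
proof -
  interpret prob_space P by (rule assms(1))
  have "(\<lambda>n. measure P {..ereal (x + inverse (real (Suc n)))}) \<longlonglongrightarrow> measure P (\<Inter>n. {..ereal (x + inverse (real (Suc n)))})"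
  proof (rule finite_Lim_measure_decseq)
    show "range (\<lambda>n. {..ereal (x + inverse (real (Suc n)))}) \<subseteq> sets P"
      unfolding assms(2) by auto
    show "decseq (\<lambda>n. {..ereal (x + inverse (real (Suc n)))})"
      unfolding decseq_def atMost_subset_iff ereal_less_eq add_le_cancel_left
      by (auto intro!: le_imp_inverse_le)
  qed
  also have "(\<Inter>n. {..ereal (x + inverse (real (Suc n)))}) = {..ereal x}"
  proof (intro equalityI subsetI)
    fix z assume z: "z \<in> (\<Inter>n. {..ereal (x + inverse (real (Suc n)))})"
    have "(\<lambda>n. ereal (x + inverse (real (Suc n)))) \<longlonglongrightarrow> ereal (x + 0)"
      by (rule tendsto_ereal[OF tendsto_add[OF tendsto_const LIMSEQ_inverse_real_of_nat]])
    then show "z \<in> {..ereal x}"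
      using z by (auto intro: LIMSEQ_le_const)
  next
    fix z assume "z \<in> {..ereal x}"
    moreover have "ereal x \<le> ereal (x + inverse (real (Suc n)))" for n by simp
    ultimately show "z \<in> (\<Inter>n. {..ereal (x + inverse (real (Suc n)))})"
      by (meson INT_I atMost_iff order_trans)
  qed
  finally have "\<forall>\<^sub>F n in sequentially. measure P {..ereal (x + inverse (real (Suc n)))} < cdf_ext P (ereal x) + e"
    by (rule order_tendstoD(2)) (use e in \<open>simp add: cdf_ext_def\<close>)
  moreover have "(\<lambda>n. ereal (x + inverse (real (Suc n)))) \<longlonglongrightarrow> ereal (x + 0)"
    by (rule tendsto_ereal[OF tendsto_add[OF tendsto_const LIMSEQ_inverse_real_of_nat]])
  then have "\<forall>\<^sub>F n in sequentially. ereal (x + inverse (real (Suc n))) < b"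
    by (rule order_tendstoD(2)) (use x in simp)
  ultimately have "\<forall>\<^sub>F n in sequentially. measure P {..ereal (x + inverse (real (Suc n)))} < cdf_ext P (ereal x) + e
      \<and> ereal (x + inverse (real (Suc n))) < b" by (rule eventually_conj)
  then obtain n where "measure P {..ereal (x + inverse (real (Suc n)))} < cdf_ext P (ereal x) + e"
      "ereal (x + inverse (real (Suc n))) < b"
    by (auto dest: eventually_happens'[OF sequentially_bot])
  then show ?thesis
    by (intro that[of "x + inverse (real (Suc n))"]) (auto simp: cdf_ext_def)
qed

lemma cdf_ext_left_approx:
  fixes P :: "ereal measure"
  assumes "prob_space P" "sets P = sets borel" and x: "a < ereal x" and e: "0 < e"
    and atom: "measure P {ereal x} = 0"
  obtains y where "y < x" "a < ereal y" "cdf_ext P (ereal x) - e < cdf_ext P (ereal y)"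
proof -
  interpret prob_space P by (rule assms(1))
  have lim: "(\<lambda>n. ereal (x - inverse (real (Suc n)))) \<longlonglongrightarrow> ereal (x - 0)"
    by (rule tendsto_ereal[OF tendsto_diff[OF tendsto_const LIMSEQ_inverse_real_of_nat]])
  have "(\<lambda>n. measure P {..ereal (x - inverse (real (Suc n)))}) \<longlonglongrightarrow> measure P (\<Union>n. {..ereal (x - inverse (real (Suc n)))})"
  proof (rule finite_Lim_measure_incseq)
    show "range (\<lambda>n. {..ereal (x - inverse (real (Suc n)))}) \<subseteq> sets P"
      unfolding assms(2) by auto
    show "incseq (\<lambda>n. {..ereal (x - inverse (real (Suc n)))})"
      unfolding incseq_def atMost_subset_iff ereal_less_eq
      by (auto intro!: diff_left_mono le_imp_inverse_le)
  qed
  also have "(\<Union>n. {..ereal (x - inverse (real (Suc n)))}) = {..<ereal x}"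
  proof (intro equalityI subsetI)
    fix z assume "z \<in> {..<ereal x}"
    then have "\<forall>\<^sub>F n in sequentially. z < ereal (x - inverse (real (Suc n)))"
      by (intro order_tendstoD(1)[OF lim]) simp
    then obtain n where "z < ereal (x - inverse (real (Suc n)))"
      by (auto dest: eventually_happens'[OF sequentially_bot])
    then show "z \<in> (\<Union>n. {..ereal (x - inverse (real (Suc n)))})" by (auto intro: less_imp_le)
  next
    fix z assume "z \<in> (\<Union>n. {..ereal (x - inverse (real (Suc n)))})"
    then obtain n where "z \<le> ereal (x - inverse (real (Suc n)))" by auto
    also have "\<dots> < ereal x" by simp
    finally show "z \<in> {..<ereal x}" by simp
  qed
  \<comment> \<open>The increasing half-lines exhaust only the open half-line; the missing atom at
    \<open>x\<close> identifies the limit with the value of the distribution function.\<close>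
  also have "measure P {..<ereal x} = cdf_ext P (ereal x)"
  proof -
    have "measure P ({..<ereal x} \<union> {ereal x}) = measure P {..<ereal x} + measure P {ereal x}"
      by (rule finite_measure_Union) (auto simp: assms(2))
    moreover have "{..<ereal x} \<union> {ereal x} = {..ereal x}" by auto
    ultimately show ?thesis using atom by (simp add: cdf_ext_def)
  qed
  finally have "\<forall>\<^sub>F n in sequentially. cdf_ext P (ereal x) - e < measure P {..ereal (x - inverse (real (Suc n)))}"
    by (rule order_tendstoD(1)) (use e in simp)
  moreover have "\<forall>\<^sub>F n in sequentially. a < ereal (x - inverse (real (Suc n)))"
    by (intro order_tendstoD(1)[OF lim]) (use x in simp)
  ultimately have "\<forall>\<^sub>F n in sequentially. cdf_ext P (ereal x) - e < measure P {..ereal (x - inverse (real (Suc n)))}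
      \<and> a < ereal (x - inverse (real (Suc n)))" by (rule eventually_conj)
  then obtain n where "cdf_ext P (ereal x) - e < measure P {..ereal (x - inverse (real (Suc n)))}"
      "a < ereal (x - inverse (real (Suc n)))"
    by (auto dest: eventually_happens'[OF sequentially_bot])
  then show ?thesis
    by (intro that[of "x - inverse (real (Suc n))"]) (auto simp: cdf_ext_def)
qed

lemma loglik_le_imp_prod_le:
  assumes n: "1 \<le> n" and \<theta>': "(\<psi>, r) \<in> Theta"
    and pos: "\<And>i. i \<in> {1..n} \<Longrightarrow> 0 < measure (cure_dist \<phi> q) (I i)"
    and le: "loglik n I (\<phi>, q) \<le> loglik n I (\<psi>, r)"
  shows "(\<Prod>i=1..n. measure (cure_dist \<phi> q) (I i)) \<le> (\<Prod>i=1..n. measure (cure_dist \<psi> r) (I i))"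
proof -
  interpret Q: prob_space "cure_dist \<psi> r" by (rule prob_space_cure_dist[OF \<theta>'])
  let ?p = "\<lambda>i. measure (cure_dist \<phi> q) (I i)" and ?r = "\<lambda>i. measure (cure_dist \<psi> r) (I i)"
  have left: "loglik n I (\<phi>, q) = ereal (1 / real n * (\<Sum>i=1..n. ln (?p i)))"
  proof -
    have "(\<Sum>i=1..n. ln_ext (?p i)) = (\<Sum>i=1..n. ereal (ln (?p i)))"
      using pos by (intro sum.cong) (force simp: ln_ext_def)+
    then show ?thesis by (simp add: loglik_def)
  qed
  \<comment> \<open>One cell of mass 0 would make the right log-likelihood
    \<open>-\<infinity>\<close>, while the left one is finite. The other terms cannot cancel this,
    since probabilities are at most 1 and their logarithms at most 0.\<close>
  have nz: "?r i \<noteq> 0" if i: "i \<in> {1..n}" for i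
  proof
    assume z: "?r i = 0"
    have "(\<Sum>k\<in>{1..n} - {i}. ln_ext (?r k)) \<le> (\<Sum>k\<in>{1..n} - {i}. 0)"
      using Q.prob_le_1 by (intro sum_mono) (auto simp: ln_ext_def less_le)
    then have "(\<Sum>k\<in>{1..n} - {i}. ln_ext (?r k)) \<noteq> \<infinity>" by auto
    moreover have "(\<Sum>k=1..n. ln_ext (?r k)) = -\<infinity> + (\<Sum>k\<in>{1..n} - {i}. ln_ext (?r k))"
      using i z by (subst sum.remove[of _ i]) (auto simp: ln_ext_def)
    ultimately have "(\<Sum>k=1..n. ln_ext (?r k)) = -\<infinity>" by simp
    then have "loglik n I (\<psi>, r) = -\<infinity>" using n by (simp add: loglik_def)
    then show False using le left by simp
  qed
  then have rpos: "0 < ?r i" if "i \<in> {1..n}" for i using that by (simp add: less_le)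
  have "loglik n I (\<psi>, r) = ereal (1 / real n * (\<Sum>i=1..n. ln (?r i)))"
  proof -
    have "(\<Sum>i=1..n. ln_ext (?r i)) = (\<Sum>i=1..n. ereal (ln (?r i)))"
      using nz by (intro sum.cong) (auto simp: ln_ext_def)
    then show ?thesis by (simp add: loglik_def)
  qed
  with le left n have "(\<Sum>i=1..n. ln (?p i)) \<le> (\<Sum>i=1..n. ln (?r i))"
    by (simp add: divide_le_cancel)
  then have "exp (\<Sum>i=1..n. ln (?p i)) \<le> exp (\<Sum>i=1..n. ln (?r i))" by simp
  then show ?thesis using pos rpos by (simp add: exp_sum)
qed


section \<open>Likelihood ratios of interval-censored observations\<close>

text \<open>Truth and design only. The estimator is left out, so that the bounds apply to an
  arbitrary competitor.\<close>

locale interval_censoring = prob_space M for M :: "'a measure" +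
  fixes \<phi> :: "real \<Rightarrow> ereal" and q :: real
    and X :: "nat \<Rightarrow> 'a \<Rightarrow> ereal"
    and A :: ereal
    and m :: "nat \<Rightarrow> nat \<Rightarrow> nat"
    and T :: "nat \<Rightarrow> nat \<Rightarrow> nat \<Rightarrow> ereal"
  assumes param: "(\<phi>, q) \<in> Theta"
    and indep: "indep_vars (\<lambda>_. borel) X {1..}"
    and distr: "1 \<le> i \<Longrightarrow> distr M borel (X i) = cure_dist \<phi> q"
    and A_less: "A < \<infinity>"
    and A_support: "x \<in> measure_support (cure_dist \<phi> q) \<Longrightarrow> A \<le> x"
    and m_pos: "1 \<le> i \<Longrightarrow> i \<le> n \<Longrightarrow> 1 \<le> m n i"
    and T_0: "1 \<le> i \<Longrightarrow> i \<le> n \<Longrightarrow> T n i 0 = A"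
    and T_last: "1 \<le> i \<Longrightarrow> i \<le> n \<Longrightarrow> T n i (m n i + 1) = \<infinity>"
    and T_less: "1 \<le> i \<Longrightarrow> i \<le> n \<Longrightarrow> j \<le> m n i \<Longrightarrow> T n i j < T n i (j + 1)"
begin

abbreviation "P \<equiv> cure_dist \<phi> q"
abbreviation "F \<equiv> cdf_ext P"

definition cell :: "nat \<Rightarrow> nat \<Rightarrow> nat \<Rightarrow> ereal set" where
  "cell n i j = {T n i (j - 1)<..T n i j}"

lemma prob_space_P: "prob_space P" by (rule prob_space_cure_dist[OF param])

lemma X_measurable: "1 \<le> i \<Longrightarrow> X i \<in> borel_measurable M"
  using indep by (auto simp: indep_vars_def)

lemma T_mono:
  assumes "1 \<le> i" "i \<le> n" "a \<le> b" "b \<le> m n i + 1"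
  shows "T n i a \<le> T n i b"
  using assms(3,4)
proof (induction b rule: dec_induct)
  case (step b)
  then show ?case using T_less[OF assms(1,2), of b] by auto
qed simp

lemma F_A: "F A = 0"
  by (rule cdf_ext_below_support[OF param A_less A_support])

lemma measure_cell:
  assumes "1 \<le> i" "i \<le> n" "j \<in> {1..m n i + 1}"
  shows "measure P (cell n i j) = F (T n i j) - F (T n i (j - 1))"
  unfolding cell_def using assms T_mono[OF assms(1,2), of "j - 1" j]
  by (intro measure_greaterThanAtMost_cdf_ext prob_space_P) auto

text \<open>Upper bound for the mass that the distributions near the step function \<open>c\<close> give to a cell.
  In the first cell the lower value is 0 and not the one at \<open>A\<close>, because the estimator may put
  mass below \<open>A\<close>; the increments then add up to 1.\<close>

definition upper_mass :: "nat \<Rightarrow> (nat \<Rightarrow> ereal) \<Rightarrow> nat \<Rightarrow> nat \<Rightarrow> nat \<Rightarrow> real" where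
  "upper_mass N c n i j = (real (threshold_count N c (T n i j)) + 1) / N -
     (if j = 1 then 0 else real (threshold_count N c (T n i (j - 1))) / N)"

text \<open>For \<open>x\<close> above \<open>A\<close> only the cell containing \<open>x\<close>
  contributes, so this bounds the square root of the likelihood ratio of observation
  \<open>i\<close>. Writing it as a finite sum of indicators makes it a simple function of
  \<open>x\<close>. A cell of \<open>P\<close>-mass 0 contributes 0 by the convention for
  division.\<close>

definition sqrt_ratio :: "nat \<Rightarrow> (nat \<Rightarrow> ereal) \<Rightarrow> nat \<Rightarrow> nat \<Rightarrow> ereal \<Rightarrow> real" where
  "sqrt_ratio N c n i x =
     (\<Sum>j=1..m n i + 1. indicator (cell n i j) x * sqrt (upper_mass N c n i j / measure P (cell n i j)))"

section \<open>Integrability and expectation of the square-root ratio\<close>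

lemma upper_mass_nonneg:
  assumes "1 \<le> i" "i \<le> n" "j \<in> {1..m n i + 1}"
  shows "0 \<le> upper_mass N c n i j"
proof -
  have "threshold_count N c (T n i (j - 1)) \<le> threshold_count N c (T n i j)"
    using assms by (intro threshold_count_mono T_mono) auto
  then have "real (threshold_count N c (T n i (j - 1))) / N \<le> (real (threshold_count N c (T n i j)) + 1) / N"
    by (intro divide_right_mono) auto
  then show ?thesis by (simp add: upper_mass_def)
qed

lemma sqrt_ratio_nonneg:
  assumes "1 \<le> i" "i \<le> n"
  shows "0 \<le> sqrt_ratio N c n i x"
  unfolding sqrt_ratio_def using upper_mass_nonneg[OF assms] by (intro sum_nonneg) auto

lemma sqrt_ratio_measurable [measurable]: "sqrt_ratio N c n i \<in> borel_measurable borel"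
  unfolding sqrt_ratio_def[abs_def] cell_def by measurable

lemma sqrt_ratio_integrable: "integrable P (sqrt_ratio N c n i)"
proof -
  interpret P: prob_space P by (rule prob_space_P)
  show ?thesis
    unfolding sqrt_ratio_def[abs_def] cell_def
    by (intro Bochner_Integration.integrable_sum integrable_mult_left integrable_real_indicator)
       (auto simp: P.emeasure_eq_measure)
qed

lemma integral_sqrt_ratio:
  assumes "1 \<le> i" "i \<le> n"
  shows "(\<integral>x. sqrt_ratio N c n i x \<partial>P) =
    (\<Sum>j=1..m n i + 1. sqrt (upper_mass N c n i j) * sqrt (measure P (cell n i j)))"
proof -
  interpret P: prob_space P by (rule prob_space_P)
  have "(\<integral>x. sqrt_ratio N c n i x \<partial>P) =
    (\<Sum>j=1..m n i + 1. measure P (cell n i j) * sqrt (upper_mass N c n i j / measure P (cell n i j)))"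
    unfolding sqrt_ratio_def[abs_def] cell_def
    by (subst Bochner_Integration.integral_sum)
       (auto simp: P.emeasure_eq_measure intro!: integrable_mult_left integrable_real_indicator)
  \<comment> \<open>The identity \<open>p * sqrt (u / p) = sqrt u * sqrt p\<close> also holds for
    \<open>p = 0\<close>, so null cells need no separate treatment.\<close>
  also have "\<dots> = (\<Sum>j=1..m n i + 1. sqrt (upper_mass N c n i j) * sqrt (measure P (cell n i j)))"
    by (intro sum.cong refl) (simp add: real_sqrt_divide real_div_sqrt divide_simps)
  finally show ?thesis .
qed

lemma integral_sqrt_ratio_le:
  fixes G :: "ereal \<Rightarrow> real"
  assumes i: "1 \<le> i" "i \<le> n" and N: "1 \<le> N" and e: "0 < e"
    and G: "mono G" "\<And>t. 0 \<le> G t \<and> G t \<le> 1" "G \<infinity> = 1"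
    and count: "\<And>j. j \<in> {1..m n i + 1} \<Longrightarrow> threshold_count N c (T n i j) \<le> N * G (T n i j) \<and>
      N * G (T n i j) < real (threshold_count N c (T n i j)) + 1"
    and sep: "\<And>t. t \<in> B \<Longrightarrow> e \<le> \<bar>G (ereal t) - F (ereal t)\<bar>"
  shows "(\<integral>x. sqrt_ratio N c n i x \<partial>P) - 1 \<le>
    - (e\<^sup>2 / 2) * (MAX j\<in>{1..m n i}. indicator (ereal ` B) (T n i j)) + 2 / sqrt N * sqrt (m n i)"
proof -
  let ?hit = "\<lambda>j. indicator (ereal ` B) (T n i j) :: real"
  \<comment> \<open>The value at index 0 is 0 and not \<open>G A\<close>: mass of \<open>G\<close>
    at or below \<open>A\<close> is counted in the first cell, as in \<open>upper_mass\<close>, and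
    the increments add up to 1.\<close>
  define a where "a = (\<lambda>j. if j = 0 then 0 else G (T n i j))"
  define b where "b = (\<lambda>j. F (T n i j))"
  have b_mono: "b (j - 1) \<le> b j" if "j \<in> {1..m n i + 1}" for j
    unfolding b_def using that i by (intro cdf_ext_mono prob_space_P T_mono) auto
  have a_mono: "a (j - 1) \<le> a j" if "j \<in> {1..m n i + 1}" for j
    unfolding a_def using that i G(2) by (auto intro!: monoD[OF G(1)] T_mono)
  \<comment> \<open>Each rounded endpoint costs at most \<open>1 / N\<close>; this gives the slack
    \<open>2 / N\<close>.\<close>
  have bracket: "upper_mass N c n i j \<le> a j - a (j - 1) + 2 / N" if j: "j \<in> {1..m n i + 1}" for j
  proof -
    have "(threshold_count N c (T n i j) + 1) / N \<le> (N * G (T n i j) + 1) / N"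
      using count[OF j] by (intro divide_right_mono) auto
    also have "\<dots> = G (T n i j) + 1 / N" using N by (simp add: field_simps)
    finally have up: "(threshold_count N c (T n i j) + 1) / N \<le> G (T n i j) + 1 / N" .
    have half: "1 / real N + 1 / real N = 2 / real N" "0 \<le> 1 / real N" by auto
    show ?thesis
    proof (cases "j = 1")
      case True
      have "(threshold_count N c (T n i j) + 1) / N \<le> G (T n i j) + 2 / N"
        using up half by linarith
      with True show ?thesis by (simp add: upper_mass_def a_def add.commute)
    next
      case False
      with j have j': "j - 1 \<in> {1..m n i + 1}" by auto
      have "(N * G (T n i (j - 1)) - 1) / N \<le> threshold_count N c (T n i (j - 1)) / N"
        using count[OF j'] by (intro divide_right_mono) auto
      then have low: "G (T n i (j - 1)) - 1 / N \<le> threshold_count N c (T n i (j - 1)) / N"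
        using N by (simp add: field_simps)
      have "(threshold_count N c (T n i j) + 1) / N - threshold_count N c (T n i (j - 1)) / N \<le>
          G (T n i j) - G (T n i (j - 1)) + 2 / N"
        using up low half by linarith
      with False j show ?thesis by (simp add: upper_mass_def a_def add.commute)
    qed
  qed
  have ends: "a 0 = 0" "a (m n i + 1) = 1" "b 0 = 0" "b (m n i + 1) = 1"
    using G(3) T_last[OF i] T_0[OF i] F_A cdf_ext_PInfty[OF prob_space_P] by (auto simp: a_def b_def)
  \<comment> \<open>An inspection time in \<open>B\<close>, if there is one, serves as the
    separating index. Otherwise the maximum is 0 and index 0, where \<open>a\<close> and
    \<open>b\<close> agree, does.\<close>
  obtain k where k: "k \<le> m n i + 1" "(e\<^sup>2 / 2) * Max (?hit ` {1..m n i}) \<le> (a k - b k)\<^sup>2 / 2"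
  proof -
    have "Max (?hit ` {1..m n i}) \<in> ?hit ` {1..m n i}" using m_pos[OF i] by (intro Max_in) auto
    then obtain j where j: "j \<in> {1..m n i}" "Max (?hit ` {1..m n i}) = ?hit j" by auto
    show ?thesis
    proof (cases "T n i j \<in> ereal ` B")
      case True
      then have "e \<le> \<bar>a j - b j\<bar>" using sep j by (auto simp: a_def b_def)
      then have "e\<^sup>2 \<le> \<bar>a j - b j\<bar>\<^sup>2" using e by (intro power_mono) auto
      then show ?thesis using True j by (intro that[of j]) auto
    next
      case False
      then show ?thesis using j by (intro that[of 0]) auto
    qed
  qed
  have "(\<integral>x. sqrt_ratio N c n i x \<partial>P) =
      (\<Sum>j=1..m n i + 1. sqrt (upper_mass N c n i j) * sqrt (b j - b (j - 1)))"
    using integral_sqrt_ratio[OF i] measure_cell[OF i] by (simp add: b_def)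
  also have "\<dots> \<le> 1 - (a k - b k)\<^sup>2 / 2 + sqrt (2 / N * real (m n i + 1))"
    using a_mono b_mono ends k(1) bracket by (intro affinity_bracket_le) auto
  \<comment> \<open>As \<open>m n i\<close> is at least 1, \<open>m n i + 1\<close> is at most twice
    \<open>m n i\<close>.\<close>
  also have "sqrt (2 / N * real (m n i + 1)) \<le> sqrt (4 / N * real (m n i))"
    using m_pos[OF i] by (intro real_sqrt_le_mono) (simp add: divide_simps)
  also have "\<dots> = 2 / sqrt N * sqrt (m n i)"
    by (simp add: real_sqrt_mult real_sqrt_divide)
  finally show ?thesis using k(2) by simp
qed

text \<open>The event depends on the code \<open>c\<close> alone; \<open>G\<close> only certifies
  that \<open>c\<close> is close to a function separated from \<open>F\<close> on \<open>B\<close>.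
  One bound thus serves all \<open>G\<close> with the same code, which is what the union bound
  requires.\<close>

lemma prob_prod_sqrt_ratio_le:
  fixes G :: "ereal \<Rightarrow> real"
  assumes N: "1 \<le> N" and e: "0 < e"
    and C: "(\<Sum>i=1..n. sqrt (m n i)) \<le> C * n"
    and G: "mono G" "\<And>t. 0 \<le> G t \<and> G t \<le> 1" "G \<infinity> = 1"
    and count: "\<And>i j. i \<in> {1..n} \<Longrightarrow> j \<in> {1..m n i + 1} \<Longrightarrow>
      threshold_count N c (T n i j) \<le> N * G (T n i j) \<and>
      N * G (T n i j) < real (threshold_count N c (T n i j)) + 1"
    and sep: "\<And>t. t \<in> B \<Longrightarrow> e \<le> \<bar>G (ereal t) - F (ereal t)\<bar>"
  shows "prob {\<omega> \<in> space M. 1 \<le> (\<Prod>i=1..n. sqrt_ratio N c n i (X i \<omega>))} \<le>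
    exp (- (e\<^sup>2 / 2 * design_freq T m n B - 2 * C / sqrt N) * n)"
proof -
  have E: "expectation (\<lambda>\<omega>. sqrt_ratio N c n i (X i \<omega>)) = (\<integral>x. sqrt_ratio N c n i x \<partial>P)" if "1 \<le> i" for i
    using that X_measurable[OF that] by (subst distr[OF that, symmetric]) (simp add: integral_distr)
  have int: "integrable M (\<lambda>\<omega>. sqrt_ratio N c n i (X i \<omega>))" if "1 \<le> i" for i
    using sqrt_ratio_integrable[of N c n i] X_measurable[OF that]
    by (subst (asm) distr[OF that, symmetric]) (simp add: integrable_distr_eq)
  have ind: "indep_vars (\<lambda>_. borel) (\<lambda>i \<omega>. sqrt_ratio N c n i (X i \<omega>)) {1..n}"
    by (rule indep_vars_compose2[OF indep_vars_subset[OF indep]]) auto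
  have "prob {\<omega> \<in> space M. 1 \<le> (\<Prod>i=1..n. sqrt_ratio N c n i (X i \<omega>))} \<le>
      exp (\<Sum>i=1..n. expectation (\<lambda>\<omega>. sqrt_ratio N c n i (X i \<omega>)) - 1)"
    using int sqrt_ratio_nonneg by (intro prod_indep_Markov ind) auto
  also have "(\<Sum>i=1..n. expectation (\<lambda>\<omega>. sqrt_ratio N c n i (X i \<omega>)) - 1) \<le>
      (\<Sum>i=1..n. - (e\<^sup>2 / 2) * (MAX j\<in>{1..m n i}. indicator (ereal ` B) (T n i j)) + 2 / sqrt N * sqrt (m n i))"
  proof (rule sum_mono)
    fix i assume i: "i \<in> {1..n}"
    then show "expectation (\<lambda>\<omega>. sqrt_ratio N c n i (X i \<omega>)) - 1 \<le>
      - (e\<^sup>2 / 2) * (MAX j\<in>{1..m n i}. indicator (ereal ` B) (T n i j)) + 2 / sqrt N * sqrt (m n i)"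
      using integral_sqrt_ratio_le[OF _ _ N e G count[OF i] sep] E by simp
  qed
  also have "\<dots> = - (e\<^sup>2 / 2) * (\<Sum>i=1..n. MAX j\<in>{1..m n i}. indicator (ereal ` B) (T n i j)) +
      2 / sqrt N * (\<Sum>i=1..n. sqrt (m n i))"
    unfolding sum.distrib sum_distrib_left ..
  also have "(\<Sum>i=1..n. MAX j\<in>{1..m n i}. indicator (ereal ` B) (T n i j)) = design_freq T m n B * n"
    by (cases "n = 0") (simp_all add: design_freq_def)
  also have "- (e\<^sup>2 / 2) * (design_freq T m n B * n) + 2 / sqrt N * (\<Sum>i=1..n. sqrt (m n i)) \<le>
      - (e\<^sup>2 / 2) * (design_freq T m n B * n) + 2 / sqrt N * (C * n)"
    using mult_left_mono[OF C, of "2 / sqrt N"] by simp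
  also have "\<dots> = - (e\<^sup>2 / 2 * design_freq T m n B - 2 * C / sqrt N) * n"
    by (simp add: algebra_simps)
  finally show ?thesis by simp
qed

text \<open>Only countably many null sets are involved. Outside them every observation falls into
  some cell, and no likelihood ratio has denominator 0.\<close>

lemma AE_X_cell_pos:
  "AE \<omega> in M. \<forall>n. \<forall>i\<in>{1..n}. A < X i \<omega> \<and>
     (\<forall>j\<in>{1..m n i + 1}. X i \<omega> \<in> cell n i j \<longrightarrow> 0 < measure P (cell n i j))"
proof -
  interpret P: prob_space P by (rule prob_space_P)
  have null: "AE \<omega> in M. X i \<omega> \<notin> S" if "1 \<le> i" "S \<in> sets borel" "measure P S = 0" for i S
  proof (rule AE_distrD[OF X_measurable[OF that(1)]])
    have "S \<in> null_sets P" using that by (simp add: null_sets_def P.emeasure_eq_measure)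
    then show "AE x in distr M borel (X i). x \<notin> S" unfolding distr[OF that(1)] by (rule AE_not_in)
  qed
  have "AE \<omega> in M. A < X i \<omega>" if "1 \<le> i" for i
    using null[OF that, of "{..A}"] F_A by (simp add: cdf_ext_def not_le)
  moreover have "AE \<omega> in M. X i \<omega> \<in> cell n i j \<longrightarrow> 0 < measure P (cell n i j)"
    if "1 \<le> i" for n i j
  proof (cases "measure P (cell n i j) = 0")
    case True
    with null[OF that, of "cell n i j"] show ?thesis by (simp add: cell_def)
  next
    case False
    then show ?thesis by (simp add: less_le)
  qed
  ultimately show ?thesis by (simp add: AE_all_countable AE_ball_countable)
qed

text \<open>The deterministic core: a competitor at least as likely as the truth has a likelihood
  ratio of at least 1, and each factor of its square root is dominated by \<open>sqrt_ratio\<close>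
  of the code of the competitor.\<close>

lemma prod_sqrt_ratio_ge_1:
  assumes n: "1 \<le> n" and N: "1 \<le> N" and \<theta>': "(\<psi>, r) \<in> Theta"
    and x: "\<And>i. i \<in> {1..n} \<Longrightarrow> A < x i"
    and pos: "\<And>i j. i \<in> {1..n} \<Longrightarrow> j \<in> {1..m n i + 1} \<Longrightarrow> x i \<in> cell n i j \<Longrightarrow> 0 < measure P (cell n i j)"
    and le: "loglik n (\<lambda>i. obs_interval (T n i) (m n i) (x i)) (\<phi>, q) \<le>
      loglik n (\<lambda>i. obs_interval (T n i) (m n i) (x i)) (\<psi>, r)"
    and count: "\<And>i j. i \<in> {1..n} \<Longrightarrow> j \<in> {1..m n i + 1} \<Longrightarrow>
      threshold_count N c (T n i j) \<le> N * cdf_ext (cure_dist \<psi> r) (T n i j) \<and>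
      N * cdf_ext (cure_dist \<psi> r) (T n i j) < real (threshold_count N c (T n i j)) + 1"
  shows "1 \<le> (\<Prod>i=1..n. sqrt_ratio N c n i (x i))"
proof -
  let ?Q = "cure_dist \<psi> r"
  let ?I = "\<lambda>i. obs_interval (T n i) (m n i) (x i)"
  let ?G = "cdf_ext ?Q"
  have Q: "prob_space ?Q" by (rule prob_space_cure_dist[OF \<theta>'])
  have ex: "\<exists>j\<in>{1..m n i + 1}. x i \<in> cell n i j" if i: "i \<in> {1..n}" for i
  proof -
    have "x i \<le> T n i (m n i + 1)" using T_last i by simp
    \<comment> \<open>The least index whose design point reaches \<open>x i\<close> is the right end
      of the cell; it is not 0 because \<open>x i\<close> exceeds \<open>A\<close>.\<close>
    then obtain k where k: "k \<le> m n i + 1" "\<forall>l<k. \<not> x i \<le> T n i l" "x i \<le> T n i k"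
      using ex_least_nat_le[of "\<lambda>k. x i \<le> T n i k"] by blast
    have "k \<noteq> 0" using k(3) x[OF i] T_0 i by (auto intro: ccontr)
    then show ?thesis using k by (intro bexI[of _ k]) (auto simp: cell_def not_le)
  qed
  then obtain j where j: "\<And>i. i \<in> {1..n} \<Longrightarrow> j i \<in> {1..m n i + 1} \<and> x i \<in> cell n i (j i)"
    by metis
  have I: "?I i = cell n i (j i)" if i: "i \<in> {1..n}" for i
    unfolding cell_def using j[OF i] i T_less by (intro obs_interval_eq) (auto simp: cell_def)
  have ppos: "0 < measure P (?I i)" if "i \<in> {1..n}" for i
    using pos[OF that] j[OF that] I[OF that] by auto
  have upper: "measure ?Q (?I i) \<le> upper_mass N c n i (j i)" if i: "i \<in> {1..n}" for i
  proof -
    have cell: "measure ?Q (?I i) = ?G (T n i (j i)) - ?G (T n i (j i - 1))"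
      unfolding I[OF i] cell_def using i j[OF i] Q
      by (intro measure_greaterThanAtMost_cdf_ext T_mono) auto
    have up: "?G (T n i (j i)) \<le> (real (threshold_count N c (T n i (j i))) + 1) / N"
      using count[of i "j i"] j[OF i] i N by (simp add: field_simps)
    show ?thesis
    \<comment> \<open>In the first cell the mass of the competitor up to \<open>A\<close> is simply
      dropped, which matches the lower value 0 in \<open>upper_mass\<close>.\<close>
    proof (cases "j i = 1")
      case True
      then show ?thesis
        using cell up cdf_ext_range(1)[OF Q, of "T n i (j i - 1)"] by (simp add: upper_mass_def)
    next
      case False
      with j[OF i] have "j i - 1 \<in> {1..m n i + 1}" by auto
      from count[OF i this] have "real (threshold_count N c (T n i (j i - 1))) / N \<le> ?G (T n i (j i - 1))"
        using N by (simp add: field_simps)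
      then show ?thesis using False cell up by (simp add: upper_mass_def)
    qed
  qed
  have "(\<Prod>i=1..n. measure P (?I i)) \<le> (\<Prod>i=1..n. measure ?Q (?I i))"
    by (rule loglik_le_imp_prod_le[OF n \<theta>' ppos le])
  moreover have "0 < (\<Prod>i=1..n. measure P (?I i))" using ppos by (intro prod_pos) auto
  ultimately have "1 \<le> sqrt ((\<Prod>i=1..n. measure ?Q (?I i)) / (\<Prod>i=1..n. measure P (?I i)))"
    by simp
  also have "\<dots> = (\<Prod>i=1..n. sqrt (measure ?Q (?I i) / measure P (?I i)))"
    by (simp only: prod_dividef[symmetric] real_sqrt_prod)
  also have "\<dots> \<le> (\<Prod>i=1..n. sqrt_ratio N c n i (x i))"
  proof (rule prod_mono, safe)
    fix i assume i: "i \<in> {1..n}"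
    have "sqrt (measure ?Q (?I i) / measure P (?I i)) \<le> sqrt (upper_mass N c n i (j i) / measure P (?I i))"
      using upper[OF i] by (intro real_sqrt_le_mono divide_right_mono) auto
    also have "\<dots> = indicator (cell n i (j i)) (x i) * sqrt (upper_mass N c n i (j i) / measure P (cell n i (j i)))"
      using j[OF i] I[OF i] by simp
    also have "\<dots> \<le> sqrt_ratio N c n i (x i)"
      unfolding sqrt_ratio_def using j[OF i] i
      by (intro member_le_sum[where f = "\<lambda>j. indicator (cell n i j) (x i) * sqrt (upper_mass N c n i j / measure P (cell n i j))"])
         (auto intro!: mult_nonneg_nonneg divide_nonneg_nonneg upper_mass_nonneg)
    finally show "sqrt (measure ?Q (?I i) / measure P (?I i)) \<le> sqrt_ratio N c n i (x i)" .
  qed simp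
  finally show ?thesis .
qed

end


section \<open>Consistency of the maximum-likelihood estimator\<close>

locale interval_censored_mle = interval_censoring M \<phi> q X A m T
  for M :: "'a measure" and \<phi> q X A m T +
  fixes \<phi>hat :: "nat \<Rightarrow> 'a \<Rightarrow> real \<Rightarrow> ereal" and qhat :: "nat \<Rightarrow> 'a \<Rightarrow> real" and \<gamma> :: real
  assumes mle: "AE \<omega> in M. \<forall>n\<ge>1.
      is_arg_max (loglik n (\<lambda>i. obs_interval (T n i) (m n i) (X i \<omega>))) (\<lambda>\<theta>. \<theta> \<in> Theta)
        (\<phi>hat n \<omega>, qhat n \<omega>)"
    and gamma: "\<gamma> > 1 / 2"
    and moment: "(\<lambda>n. (1 / real n) * (\<Sum>i = 1..n. real (m n i) powr \<gamma>)) \<in> O(\<lambda>_. 1)"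
begin

abbreviation "Fhat n \<omega> \<equiv> cdf_ext (cure_dist (\<phi>hat n \<omega>) (qhat n \<omega>))"

text \<open>The code of the estimator varies with \<open>\<omega>\<close> but stays in a finite set
  of codes, so almost surely the bad event lies in a finite union of measurable events
  \<open>E c\<close> that do not mention the estimator.\<close>

lemma outer_measure_separated_le:
  assumes n: "1 \<le> n" and N: "1 \<le> N" and e: "0 < e"
    and C: "(\<Sum>i=1..n. sqrt (m n i)) \<le> C * n"
  shows "outer_measure_of M {\<omega> \<in> space M. \<forall>t\<in>B. e \<le> \<bar>Fhat n \<omega> (ereal t) - F (ereal t)\<bar>} \<le>
    ennreal ((2 * C\<^sup>2 * real n ^ 2) ^ N * exp (- (e\<^sup>2 / 2 * design_freq T m n B - 2 * C / sqrt N) * n))"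
    (is "outer_measure_of M ?S \<le> ennreal (?K ^ N * ?x)")
proof -
  define D where "D = (\<lambda>(i, j). T n i j) ` (SIGMA i:{1..n}. {1..m n i + 1})"
  have D: "finite D" by (simp add: D_def)
  have top: "\<infinity> \<in> D"
    using n T_last[of 1 n] by (force simp: D_def intro!: image_eqI[of _ _ "(1, m n 1 + 1)"])
  have T_D: "T n i j \<in> D" if "i \<in> {1..n}" "j \<in> {1..m n i + 1}" for i j
    using that unfolding D_def by force
  let ?count = "\<lambda>c (G :: ereal \<Rightarrow> real) t. real (threshold_count N c t) \<le> N * G t \<and> N * G t < real (threshold_count N c t) + 1"
  \<comment> \<open>Only codes of some separated distribution function are kept, so the exponential
    bound applies to each of them.\<close>
  define \<C> where "\<C> = {c \<in> {1..N} \<rightarrow>\<^sub>E D. \<exists>G :: ereal \<Rightarrow> real. mono G \<and> (\<forall>t. 0 \<le> G t \<and> G t \<le> 1) \<and> G \<infinity> = 1 \<and>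
    (\<forall>t\<in>D. ?count c G t) \<and> (\<forall>t\<in>B. e \<le> \<bar>G (ereal t) - F (ereal t)\<bar>)}"
  have fin: "finite \<C>" unfolding \<C>_def using D by (intro finite_Collect_conjI disjI1) (simp add: finite_PiE)
  define E where "E = (\<lambda>c. {\<omega> \<in> space M. 1 \<le> (\<Prod>i=1..n. sqrt_ratio N c n i (X i \<omega>))})"
  have E_sets: "E c \<in> events" for c
  proof -
    have [measurable]: "X i \<in> borel_measurable M" if "i \<in> {1..n}" for i
      using X_measurable that by simp
    show ?thesis unfolding E_def by measurable
  qed
  have E_le: "prob (E c) \<le> ?x" if c: "c \<in> \<C>" for c
  proof -
    from c obtain G :: "ereal \<Rightarrow> real" where G: "mono G" "\<And>t. 0 \<le> G t \<and> G t \<le> 1" "G \<infinity> = 1"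
      "\<And>t. t \<in> D \<Longrightarrow> ?count c G t" "\<And>t. t \<in> B \<Longrightarrow> e \<le> \<bar>G (ereal t) - F (ereal t)\<bar>"
      unfolding \<C>_def by blast
    show ?thesis
      unfolding E_def by (rule prob_prod_sqrt_ratio_le[OF N e C G(1,2,3) G(4)[OF T_D] G(5)])
  qed
  \<comment> \<open>Only the sum of \<open>sqrt (m n i)\<close> is controlled, so the number of
    design points is bounded through its square: a sum of squares of nonnegative numbers is at most
    the square of their sum. This is why \<open>n\<close> enters quadratically.\<close>
  have card: "real (card \<C>) \<le> ?K ^ N"
  proof -
    have "real (card D) \<le> (\<Sum>i=1..n. real (m n i + 1))"
    proof -
      have "card D \<le> card (SIGMA i:{1..n}. {1..m n i + 1})"
        unfolding D_def by (intro card_image_le) auto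
      also have "\<dots> = (\<Sum>i=1..n. m n i + 1)" by simp
      finally have "real (card D) \<le> real (\<Sum>i=1..n. m n i + 1)" by (rule of_nat_mono)
      then show ?thesis by (simp only: of_nat_sum)
    qed
    also have "\<dots> \<le> (\<Sum>i=1..n. 2 * (sqrt (m n i))\<^sup>2)"
      using m_pos by (intro sum_mono) fastforce
    also have "\<dots> \<le> 2 * (\<Sum>i=1..n. sqrt (m n i))\<^sup>2"
    proof -
      have "(L2_set (\<lambda>i. sqrt (m n i)) {1..n})\<^sup>2 \<le> (\<Sum>i=1..n. sqrt (m n i))\<^sup>2"
        by (intro power_mono L2_set_le_sum L2_set_nonneg) auto
      then show ?thesis by (simp add: L2_set_def sum_nonneg flip: sum_distrib_left)
    qed
    also have "\<dots> \<le> 2 * (C * n)\<^sup>2"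
      using C by (intro mult_left_mono power_mono sum_nonneg) auto
    finally have D_le: "real (card D) \<le> ?K" by (simp add: power_mult_distrib)
    have "card \<C> \<le> card ({1..N} \<rightarrow>\<^sub>E D)"
      using D by (intro card_mono finite_PiE) (auto simp: \<C>_def)
    also have "\<dots> = card D ^ N" by (simp add: card_PiE)
    finally have "real (card \<C>) \<le> real (card D) ^ N" by (simp flip: of_nat_power)
    also have "\<dots> \<le> ?K ^ N" using D_le by (intro power_mono) auto
    finally show ?thesis .
  qed
  have "AE \<omega> in M. \<omega> \<in> ?S \<longrightarrow> \<omega> \<in> (\<Union>c\<in>\<C>. E c)"
    using mle AE_X_cell_pos
  proof eventually_elim
    case (elim \<omega>)
    note arg_max = elim(1) and cells = elim(2)
    show ?case
    proof
      assume \<omega>: "\<omega> \<in> ?S"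
      from arg_max n have \<theta>: "(\<phi>hat n \<omega>, qhat n \<omega>) \<in> Theta"
        and le: "loglik n (\<lambda>i. obs_interval (T n i) (m n i) (X i \<omega>)) (\<phi>, q) \<le>
          loglik n (\<lambda>i. obs_interval (T n i) (m n i) (X i \<omega>)) (\<phi>hat n \<omega>, qhat n \<omega>)"
        using param by (auto simp: is_arg_max_def not_less)
      have Q: "prob_space (cure_dist (\<phi>hat n \<omega>) (qhat n \<omega>))" by (rule prob_space_cure_dist[OF \<theta>])
      have G: "mono (Fhat n \<omega>)" "\<And>t. 0 \<le> Fhat n \<omega> t \<and> Fhat n \<omega> t \<le> 1" "Fhat n \<omega> \<infinity> = 1"
        using cdf_ext_mono[OF Q] cdf_ext_range[OF Q] cdf_ext_PInfty[OF Q] by (auto intro: monoI)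
      obtain c where c: "c \<in> {1..N} \<rightarrow>\<^sub>E D" "\<And>t. t \<in> D \<Longrightarrow> ?count c (Fhat n \<omega>) t"
        using monotone_quantization[OF D top mono_on_subset[OF G(1) subset_UNIV] G(2,3), of N] by blast
      have "c \<in> \<C>" unfolding \<C>_def using c G \<omega> by blast
      moreover have "1 \<le> (\<Prod>i=1..n. sqrt_ratio N c n i (X i \<omega>))"
        using cells by (intro prod_sqrt_ratio_ge_1[OF n N \<theta> _ _ le c(2)[OF T_D]]) auto
      ultimately show "\<omega> \<in> (\<Union>c\<in>\<C>. E c)" unfolding E_def using \<omega> by blast
    qed
  qed
  then have "outer_measure_of M ?S \<le> outer_measure_of M (\<Union>c\<in>\<C>. E c)"
    by (rule outer_measure_of_mono_AE) (auto simp: E_def)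
  also have "\<dots> = emeasure M (\<Union>c\<in>\<C>. E c)"
    using E_sets fin by (intro outer_measure_of_eq) auto
  also have "\<dots> = ennreal (prob (\<Union>c\<in>\<C>. E c))" by (rule emeasure_eq_measure)
  also have "prob (\<Union>c\<in>\<C>. E c) \<le> (\<Sum>c\<in>\<C>. prob (E c))"
    using E_sets fin by (intro finite_measure_subadditive_finite) auto
  also have "\<dots> \<le> card \<C> * ?x" using sum_bounded_above[of \<C> "\<lambda>c. prob (E c)" ?x] E_le by simp
  also have "\<dots> \<le> ?K ^ N * ?x" using card by (intro mult_right_mono) auto
  finally show ?thesis by (simp add: ennreal_leI)
qed

section \<open>Choice of constants and decay of the separation event\<close>

lemma sum_sqrt_bounded:
  obtains C :: real where "0 < C" "\<forall>\<^sub>F n in sequentially. (\<Sum>i=1..n. sqrt (m n i)) \<le> C * n"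
proof -
  obtain C where C: "0 < C"
    "\<forall>\<^sub>F n in sequentially. norm ((1 / real n) * (\<Sum>i=1..n. real (m n i) powr \<gamma>)) \<le> C * norm (1 :: real)"
    using moment by (auto elim!: landau_o.bigE)
  from C(2) eventually_ge_at_top[of 1]
  have "\<forall>\<^sub>F n in sequentially. (\<Sum>i=1..n. sqrt (m n i)) \<le> C * n"
  proof eventually_elim
    case (elim n)
    have "(\<Sum>i=1..n. sqrt (m n i)) \<le> (\<Sum>i=1..n. real (m n i) powr \<gamma>)"
    proof (rule sum_mono)
      fix i assume "i \<in> {1..n}"
      \<comment> \<open>For a base of at least 1 the exponent \<open>1 / 2\<close> may be raised to
        \<open>\<gamma>\<close>.\<close>
      then have "1 \<le> real (m n i)" using m_pos[of i n] by simp
      then show "sqrt (m n i) \<le> real (m n i) powr \<gamma>"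
        using gamma by (simp add: powr_half_sqrt[symmetric] powr_mono)
    qed
    also have "\<dots> \<le> C * n"
      using elim by (simp add: field_simps sum_nonneg)
    finally show ?case .
  qed
  with C(1) show ?thesis by (rule that)
qed

lemma outer_measure_separated_tendsto_0:
  assumes freq: "liminf (\<lambda>n. ereal (design_freq T m n B)) > 0" and e: "0 < e"
  shows "(\<lambda>n. outer_measure_of M {\<omega> \<in> space M. \<forall>t\<in>B. e \<le> \<bar>Fhat n \<omega> (ereal t) - F (ereal t)\<bar>}) \<longlonglongrightarrow> 0"
proof -
  obtain C :: real where C: "0 < C" "\<forall>\<^sub>F n in sequentially. (\<Sum>i=1..n. sqrt (m n i)) \<le> C * n"
    by (rule sum_sqrt_bounded)
  obtain h where h: "0 < ereal h" "ereal h < liminf (\<lambda>n. ereal (design_freq T m n B))"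
    using ereal_dense2[OF freq] by blast
  \<comment> \<open>Half of the eventual gain \<open>e^2 / 2 * h\<close> from separation.
    \<open>N\<close> is chosen so that the rounding error \<open>2 * C / sqrt N\<close> uses up at
    most the other half, leaving the rate \<open>\<kappa>\<close>.\<close>
  define \<kappa> where "\<kappa> = e\<^sup>2 / 4 * h"
  have \<kappa>: "0 < \<kappa>" using e h by (simp add: \<kappa>_def)
  obtain N :: nat where N: "(2 * C / \<kappa>)\<^sup>2 < N" using reals_Archimedean2 by blast
  have N1: "1 \<le> N" using N by (cases N) (auto simp: not_less)
  have "2 * C / \<kappa> \<le> sqrt N" using N by (intro real_le_rsqrt) simp
  then have N2: "2 * C / sqrt N \<le> \<kappa>" using \<kappa> N1 by (simp add: field_simps)
  have lim: "(\<lambda>n. ennreal ((2 * C\<^sup>2 * real n ^ 2) ^ N * exp (- \<kappa> * n))) \<longlonglongrightarrow> ennreal 0"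
    by (intro tendsto_ennrealI power_times_exp_tendsto_0 \<kappa>)
  have "\<forall>\<^sub>F n in sequentially. h < design_freq T m n B"
    using less_LiminfD[OF h(2)] by simp
  then have "\<forall>\<^sub>F n in sequentially.
    outer_measure_of M {\<omega> \<in> space M. \<forall>t\<in>B. e \<le> \<bar>Fhat n \<omega> (ereal t) - F (ereal t)\<bar>} \<le>
    ennreal ((2 * C\<^sup>2 * real n ^ 2) ^ N * exp (- \<kappa> * n))"
    using C(2) eventually_ge_at_top[of 1]
  proof eventually_elim
    case (elim n)
    have "e\<^sup>2 / 2 * h \<le> e\<^sup>2 / 2 * design_freq T m n B" using elim by (intro mult_left_mono) auto
    then have "\<kappa> \<le> e\<^sup>2 / 2 * design_freq T m n B - 2 * C / sqrt N"
      using N2 unfolding \<kappa>_def by linarith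
    then have "- (e\<^sup>2 / 2 * design_freq T m n B - 2 * C / sqrt N) * n \<le> - \<kappa> * n"
      by (intro mult_right_mono) auto
    then have "(2 * C\<^sup>2 * real n ^ 2) ^ N * exp (- (e\<^sup>2 / 2 * design_freq T m n B - 2 * C / sqrt N) * n) \<le>
      (2 * C\<^sup>2 * real n ^ 2) ^ N * exp (- \<kappa> * n)"
      by (intro mult_left_mono) auto
    with outer_measure_separated_le[OF elim(3) N1 e elim(2), of B] show ?case
      by (meson ennreal_leI order_trans)
  qed
  from tendsto_sandwich[OF _ this tendsto_const lim[unfolded ennreal_0]] show ?thesis by simp
qed

lemma Fhat_mono: "AE \<omega> in M. \<forall>n\<ge>1. mono (Fhat n \<omega>)"
  using mle
proof eventually_elim
  case (elim \<omega>)
  then have "(\<phi>hat n \<omega>, qhat n \<omega>) \<in> Theta" if "1 \<le> n" for n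
    using that by (simp add: is_arg_max_def)
  then show ?case by (auto intro!: monoI cdf_ext_mono prob_space_cure_dist)
qed

text \<open>Reduces each assertion to a pointwise implication: the deviation \<open>R\<close> must
  force separation on all of \<open>B\<close>. Monotonicity of \<open>Fhat\<close> is a premise of
  \<open>sep\<close> because it holds only almost surely.\<close>

lemma outer_measure_tendsto_0I:
  assumes freq: "liminf (\<lambda>n. ereal (design_freq T m n B)) > 0" and e: "0 < e"
    and sep: "\<And>n \<omega> t. mono (Fhat n \<omega>) \<Longrightarrow> R n \<omega> \<Longrightarrow> t \<in> B \<Longrightarrow> e \<le> \<bar>Fhat n \<omega> (ereal t) - F (ereal t)\<bar>"
  shows "(\<lambda>n. outer_measure_of M {\<omega> \<in> space M. R n \<omega>}) \<longlonglongrightarrow> 0"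
proof -
  let ?S = "\<lambda>n. {\<omega> \<in> space M. \<forall>t\<in>B. e \<le> \<bar>Fhat n \<omega> (ereal t) - F (ereal t)\<bar>}"
  have "outer_measure_of M {\<omega> \<in> space M. R n \<omega>} \<le> outer_measure_of M (?S n)" if "1 \<le> n" for n
  proof (rule outer_measure_of_mono_AE)
    show "AE \<omega> in M. \<omega> \<in> {\<omega> \<in> space M. R n \<omega>} \<longrightarrow> \<omega> \<in> ?S n"
      using Fhat_mono by eventually_elim (use that sep in blast)
  qed auto
  then have "\<forall>\<^sub>F n in sequentially. outer_measure_of M {\<omega> \<in> space M. R n \<omega>} \<le> outer_measure_of M (?S n)"
    by (rule eventually_sequentiallyI)
  from tendsto_sandwich[OF _ this tendsto_const outer_measure_separated_tendsto_0[OF freq e]]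
  show ?thesis by simp
qed

section \<open>One-sided bounds and pointwise convergence\<close>

lemma F_mono: "s \<le> t \<Longrightarrow> F s \<le> F t"
  by (rule cdf_ext_mono[OF prob_space_P]) auto

text \<open>For \<open>t\<close> between \<open>x\<close> and \<open>y\<close>, monotonicity gives
  \<open>Fhat x <= Fhat t\<close> and \<open>F t <= F y\<close>. An excess of \<open>Fhat x\<close>
  over \<open>F y\<close> therefore persists at every \<open>t\<close> in the interval.\<close>

lemma Fhat_le_plus_op:
  assumes "x \<le> y" and freq: "liminf (\<lambda>n. ereal (design_freq T m n {x..y})) > 0"
  shows "le_plus_op M (\<lambda>n \<omega>. Fhat n \<omega> (ereal x)) (F (ereal y))"
  unfolding le_plus_op_def tendsto_in_prob_def
proof (intro allI impI)
  fix e :: real assume e: "0 < e"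
  show "(\<lambda>n. outer_measure_of M {\<omega> \<in> space M. e < \<bar>max (Fhat n \<omega> (ereal x) - F (ereal y)) 0 - 0\<bar>}) \<longlonglongrightarrow> 0"
  proof (rule outer_measure_tendsto_0I[OF freq e])
    fix n \<omega> t
    assume *: "mono (Fhat n \<omega>)" "e < \<bar>max (Fhat n \<omega> (ereal x) - F (ereal y)) 0 - 0\<bar>" "t \<in> {x..y}"
    then have "Fhat n \<omega> (ereal x) \<le> Fhat n \<omega> (ereal t)" "F (ereal t) \<le> F (ereal y)"
      by (auto intro!: F_mono elim: monoD)
    with *(2) e show "e \<le> \<bar>Fhat n \<omega> (ereal t) - F (ereal t)\<bar>" by linarith
  qed
qed

lemma Fhat_ge_plus_op:
  assumes "x \<le> y" and freq: "liminf (\<lambda>n. ereal (design_freq T m n {x..y})) > 0"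
  shows "ge_plus_op M (\<lambda>n \<omega>. Fhat n \<omega> (ereal y)) (F (ereal x))"
  unfolding ge_plus_op_def tendsto_in_prob_def
proof (intro allI impI)
  fix e :: real assume e: "0 < e"
  show "(\<lambda>n. outer_measure_of M {\<omega> \<in> space M. e < \<bar>max (F (ereal x) - Fhat n \<omega> (ereal y)) 0 - 0\<bar>}) \<longlonglongrightarrow> 0"
  proof (rule outer_measure_tendsto_0I[OF freq e])
    fix n \<omega> t
    assume *: "mono (Fhat n \<omega>)" "e < \<bar>max (F (ereal x) - Fhat n \<omega> (ereal y)) 0 - 0\<bar>" "t \<in> {x..y}"
    then have "Fhat n \<omega> (ereal t) \<le> Fhat n \<omega> (ereal y)" "F (ereal x) \<le> F (ereal t)"
      by (auto intro!: F_mono elim: monoD)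
    with *(2) e show "e \<le> \<bar>Fhat n \<omega> (ereal t) - F (ereal t)\<bar>" by linarith
  qed
qed

text \<open>By continuity \<open>F\<close> changes by less than \<open>e / 2\<close> from
  \<open>w\<close> to \<open>x\<close> and from \<open>x\<close> to \<open>y\<close>. An upward
  deviation by \<open>e\<close> at \<open>x\<close> then leaves separation \<open>e / 2\<close> on
  all of \<open>(x, y)\<close>, a downward one on all of \<open>(w, x)\<close>.\<close>

lemma Fhat_tendsto_in_prob:
  assumes freq: "\<And>u v. a \<le> u \<Longrightarrow> u < v \<Longrightarrow> v \<le> b \<Longrightarrow>
      liminf (\<lambda>n. ereal (design_freq T m n {z. u < ereal z \<and> ereal z < v})) > 0"
    and x: "a < ereal x" "ereal x < b"
  shows "tendsto_in_prob M (\<lambda>n \<omega>. Fhat n \<omega> (ereal x)) (F (ereal x))"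
  unfolding tendsto_in_prob_def
proof (intro allI impI)
  fix e :: real assume e: "0 < e"
  then have e2: "0 < e / 2" by simp
  obtain y where y: "x < y" "ereal y < b" "F (ereal y) < F (ereal x) + e / 2"
    using cdf_ext_right_approx[OF prob_space_P _ x(2) e2] by auto
  obtain w where w: "w < x" "a < ereal w" "F (ereal x) - e / 2 < F (ereal w)"
    using cdf_ext_left_approx[OF prob_space_P _ x(1) e2 measure_cure_dist_singleton[OF param]] by auto
  let ?up = "\<lambda>n \<omega>. F (ereal x) + e < Fhat n \<omega> (ereal x)" and ?low = "\<lambda>n \<omega>. Fhat n \<omega> (ereal x) < F (ereal x) - e"
  have up: "(\<lambda>n. outer_measure_of M {\<omega> \<in> space M. ?up n \<omega>}) \<longlonglongrightarrow> 0"
  proof (rule outer_measure_tendsto_0I[OF freq[of "ereal x" "ereal y"] e2])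
    fix n \<omega> t
    assume *: "mono (Fhat n \<omega>)" "?up n \<omega>" "t \<in> {z. ereal x < ereal z \<and> ereal z < ereal y}"
    then have "Fhat n \<omega> (ereal x) \<le> Fhat n \<omega> (ereal t)" "F (ereal t) \<le> F (ereal y)"
      by (auto intro!: F_mono elim: monoD)
    with *(2) y(3) show "e / 2 \<le> \<bar>Fhat n \<omega> (ereal t) - F (ereal t)\<bar>" by linarith
  qed (use x y in auto)
  have low: "(\<lambda>n. outer_measure_of M {\<omega> \<in> space M. ?low n \<omega>}) \<longlonglongrightarrow> 0"
  proof (rule outer_measure_tendsto_0I[OF freq[of "ereal w" "ereal x"] e2])
    fix n \<omega> t
    assume *: "mono (Fhat n \<omega>)" "?low n \<omega>" "t \<in> {z. ereal w < ereal z \<and> ereal z < ereal x}"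
    then have "Fhat n \<omega> (ereal t) \<le> Fhat n \<omega> (ereal x)" "F (ereal w) \<le> F (ereal t)"
      by (auto intro!: F_mono elim: monoD)
    with *(2) w(3) show "e / 2 \<le> \<bar>Fhat n \<omega> (ereal t) - F (ereal t)\<bar>" by linarith
  qed (use x w in auto)
  have "outer_measure_of M {\<omega> \<in> space M. e < \<bar>Fhat n \<omega> (ereal x) - F (ereal x)\<bar>} \<le>
      outer_measure_of M {\<omega> \<in> space M. ?up n \<omega>} + outer_measure_of M {\<omega> \<in> space M. ?low n \<omega>}" for n
    by (rule order_trans[OF outer_measure_of_mono outer_measure_of_Un_le]) auto
  from tendsto_sandwich[OF _ always_eventually[OF allI[OF this]] tendsto_const tendsto_add[OF up low]]
  show "(\<lambda>n. outer_measure_of M {\<omega> \<in> space M. e < \<bar>Fhat n \<omega> (ereal x) - F (ereal x)\<bar>}) \<longlonglongrightarrow> 0"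
    by simp
qed

end

theorem corollary5p2:
  fixes M :: "'a measure"
    and \<phi> :: "real \<Rightarrow> ereal" and q :: real
    and X :: "nat \<Rightarrow> 'a \<Rightarrow> ereal"
    and A :: ereal
    and m :: "nat \<Rightarrow> nat \<Rightarrow> nat"
    and T :: "nat \<Rightarrow> nat \<Rightarrow> nat \<Rightarrow> ereal"
    and \<phi>hat :: "nat \<Rightarrow> 'a \<Rightarrow> real \<Rightarrow> ereal"
    and qhat :: "nat \<Rightarrow> 'a \<Rightarrow> real"
    and F :: "ereal \<Rightarrow> real"
    and Fhat :: "nat \<Rightarrow> 'a \<Rightarrow> ereal \<Rightarrow> real"
    and \<gamma> :: real
  defines "F \<equiv> cdf_ext (cure_dist \<phi> q)"
    and "Fhat \<equiv> \<lambda>n \<omega>. cdf_ext (cure_dist (\<phi>hat n \<omega>) (qhat n \<omega>))"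
  assumes "prob_space M"
    and "(\<phi>, q) \<in> Theta"
    and "prob_space.indep_vars M (\<lambda>_. borel) X {1..}"
    and "\<And>i. 1 \<le> i \<Longrightarrow> distr M borel (X i) = cure_dist \<phi> q"
    and "A < \<infinity>"
    and "\<And>x. x \<in> measure_support (cure_dist \<phi> q) \<Longrightarrow> A \<le> x"
    and "\<And>n i. 1 \<le> i \<Longrightarrow> i \<le> n \<Longrightarrow> 1 \<le> m n i"
    and "\<And>n i. 1 \<le> i \<Longrightarrow> i \<le> n \<Longrightarrow> T n i 0 = A"
    and "\<And>n i. 1 \<le> i \<Longrightarrow> i \<le> n \<Longrightarrow> T n i (m n i + 1) = \<infinity>"
    and "\<And>n i j. 1 \<le> i \<Longrightarrow> i \<le> n \<Longrightarrow> j \<le> m n i \<Longrightarrow> T n i j < T n i (j + 1)"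
    and "AE \<omega> in M. \<forall>n\<ge>1.
      is_arg_max (loglik n (\<lambda>i. obs_interval (T n i) (m n i) (X i \<omega>))) (\<lambda>\<theta>. \<theta> \<in> Theta)
        (\<phi>hat n \<omega>, qhat n \<omega>)"
    and "\<gamma> > 1 / 2"
    and "(\<lambda>n. (1 / real n) * (\<Sum>i = 1..n. real (m n i) powr \<gamma>)) \<in> O(\<lambda>_. 1)"
  shows "(\<forall>x y :: real. x \<le> y \<longrightarrow>
            liminf (\<lambda>n. ereal (design_freq T m n {x..y})) > 0 \<longrightarrow>
            le_plus_op M (\<lambda>n \<omega>. Fhat n \<omega> (ereal x)) (F (ereal y)) \<and>
            ge_plus_op M (\<lambda>n \<omega>. Fhat n \<omega> (ereal y)) (F (ereal x))) \<and>
         (\<forall>a b :: ereal. a < b \<longrightarrow>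
            (\<forall>x y. a \<le> x \<longrightarrow> x < y \<longrightarrow> y \<le> b \<longrightarrow>
               liminf (\<lambda>n. ereal (design_freq T m n {z. x < ereal z \<and> ereal z < y})) > 0) \<longrightarrow>
            (\<forall>x :: real. a < ereal x \<longrightarrow> ereal x < b \<longrightarrow>
               tendsto_in_prob M (\<lambda>n \<omega>. Fhat n \<omega> (ereal x)) (F (ereal x))))"
proof -
  interpret interval_censored_mle M \<phi> q X A m T \<phi>hat qhat \<gamma>
    using assms(3-) by (auto intro!: interval_censored_mle.intro interval_censoring.intro
      interval_censoring_axioms.intro interval_censored_mle_axioms.intro)
  show ?thesis
    unfolding F_def Fhat_def
    using Fhat_le_plus_op Fhat_ge_plus_op Fhat_tendsto_in_prob by blast
qed

end
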